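(* There is a constant $C$, independent of $u$, such that the following holds. Let $u:U\subset\mathbb{R}^3\to\mathbb{R}$ be an axisymmetric function such that, as a function of $(r,z)$, $u\in BV(\Omega)$ and $\operatorname{supp}(u)\subset[0,1)\times[-1,1]$. If $\mathcal{A}u=f$, then $$\|u\|_{L^1(U)}\le C\,\|u\|_{TV(\Omega)}^{1/3}\,\|f\|_{L^1(\Omega)}^{2/3}.$$
   Context: $\Omega=[0,1]\times[-1,1]\subset\mathbb{R}^2$ and $U=\{(x,y)\in\mathbb{R}^2:x^2+y^2\le1\}\times[-1,1]\subset\mathbb{R}^3$. A function $u$ on $U$ is axisymmetric if it depends only on $r=\sqrt{x^2+y^2}$ and $z$; it is then also written $u(r,z)$, $(r,z)\in\Omega$, and it is extended by zero for $r\ge1$. The Abel transform of $u$ is $$\mathcal{A}u(x,z):=2\int_x^\infty\frac{u(r,z)\,r}{\sqrt{r^2-x^2}}\,dr,\qquad (x,z)\in[0,\infty)\times\mathbb{R}.$$ The norm on the left is $\|u\|_{L^1(U)}:=\int_{-1}^1\iint_{B(0,1)}|u(x,y,z)|\,dx\,dy\,dz$, with $B(0,1)$ the unit ball of $\mathbb{R}^2$. The total variation with respect to $(r,z)$ is $$\|u\|_{TV(\Omega)}:=\sup\left\{\iint_\Omega u(r,z)\,\operatorname{div}\phi(r,z)\,dr\,dz:\ \phi\in C_c^1((0,1)\times(-1,1);\mathbb{R}^2),\ \|\phi\|_{L^\infty(\Omega)}\le1\right\},$$ where $\operatorname{div}$ is taken in the variables $(r,z)$. $BV(\Omega)$ is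 understood on the interior of $\Omega$. *)

theory Defs
  imports "HOL-Analysis.Analysis"
begin

definition Omega :: "(real \<times> real) set" where
  "Omega = {0..1} \<times> {-1..1}"

definition cylinder :: "(real \<times> real \<times> real) set" where
  "cylinder = {(x, y, z). x\<^sup>2 + y\<^sup>2 \<le> 1 \<and> -1 \<le> z \<and> z \<le> 1}"

text \<open>A function on the cylinder is modelled by a total function; its values off the cylinder
  are never used.\<close>

definition axisymmetric :: "(real \<times> real \<times> real \<Rightarrow> real) \<Rightarrow> bool" where
  "axisymmetric u \<longleftrightarrow>
     (\<exists>v. \<forall>(x, y, z) \<in> cylinder. u (x, y, z) = v (sqrt (x\<^sup>2 + y\<^sup>2)) z)"

text \<open>The function \<open>u(r,z)\<close> of an axisymmetric \<open>u\<close>, read off along the half-plane \<open>y = 0\<close>, \<open>x \<ge> 0\<close>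
  and extended by zero for \<open>r \<ge> 1\<close> as well as for \<open>z\<close> outside \<open>[-1,1]\<close>.\<close>

definition profile :: "(real \<times> real \<times> real \<Rightarrow> real) \<Rightarrow> real \<times> real \<Rightarrow> real" where
  "profile u = (\<lambda>(r, z). if 0 \<le> r \<and> r < 1 \<and> -1 \<le> z \<and> z \<le> 1 then u (r, 0, z) else 0)"

text \<open>All integrals and null sets refer to the complete measure \<^const>\<open>lebesgue\<close>, so that changing
  a function on a null set affects neither measurability nor norms.\<close>

definition abel_transform :: "(real \<times> real \<Rightarrow> real) \<Rightarrow> real \<times> real \<Rightarrow> real" where
  "abel_transform v =
     (\<lambda>(x, z). 2 * (LINT r:{x<..}|lebesgue. v (r, z) * r / sqrt (r\<^sup>2 - x\<^sup>2)))"

definition L1_norm :: "'a::euclidean_space set \<Rightarrow> ('a \<Rightarrow> real) \<Rightarrow> ennreal" where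
  "L1_norm S f = (\<integral>\<^sup>+p\<in>S. ennreal \<bar>f p\<bar> \<partial>lebesgue)"

text \<open>The support of an almost-everywhere class: the complement of the largest open set on which
  the function vanishes almost everywhere. It is contained in the closure of the set of non-zeros.\<close>

definition ess_support :: "('a::euclidean_space \<Rightarrow> real) \<Rightarrow> 'a set" where
  "ess_support f =
     {p. \<forall>W. open W \<and> p \<in> W \<longrightarrow> \<not> (AE q in lebesgue. q \<in> W \<longrightarrow> f q = 0)}"

text \<open>Compactly supported fields on the open rectangle are identified with their extensions by zero
  to the plane. Containment of the closed support in the bounded rectangle makes it compact. The
  norm on pairs is the Euclidean one, and for continuous fields the pointwise bound is the
  \<open>L\<^sup>\<infinity>\<close> bound.\<close>

definition test_fields :: "(real \<times> real \<Rightarrow> real \<times> real) set" where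
  "test_fields = {\<phi>.
     (\<forall>p. \<phi> differentiable (at p)) \<and>
     (\<forall>h. continuous_on UNIV (\<lambda>p. frechet_derivative \<phi> (at p) h)) \<and>
     closure {p. \<phi> p \<noteq> 0} \<subseteq> interior Omega \<and>
     (\<forall>p\<in>Omega. norm (\<phi> p) \<le> 1)}"

definition divergence :: "(real \<times> real \<Rightarrow> real \<times> real) \<Rightarrow> real \<times> real \<Rightarrow> real" where
  "divergence \<phi> p =
     fst (frechet_derivative \<phi> (at p) (1, 0)) + snd (frechet_derivative \<phi> (at p) (0, 1))"

text \<open>Since \<open>test_fields\<close> is closed under negation, truncating negative integrals to zero by
  \<^const>\<open>ennreal\<close> does not change the supremum.\<close>

definition TV :: "(real \<times> real \<Rightarrow> real) \<Rightarrow> ennreal" where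
  "TV v = (SUP \<phi>\<in>test_fields. ennreal (LINT p:Omega|lebesgue. v p * divergence \<phi> p))"

definition BV :: "(real \<times> real \<Rightarrow> real) set" where
  "BV = {v. set_integrable lebesgue (interior Omega) v \<and> TV v < \<infinity>}"

end

theory Submission imports Defs begin

text \<open>In the variable \<open>r\<^sup>2\<close> the Abel transform is an integration of order one half. Hence
\<open>\<parallel>f\<parallel>\<close> controls \<open>u\<close> up to half a derivative, while the total variation controls one full
derivative of \<open>u\<close>, and interpolating between the two at order zero produces the exponents
\<open>2/3\<close> and \<open>1/3\<close>. Concretely, the norm of \<open>u\<close> on the cylinder is \<open>2 \<pi> \<integral>\<integral> |u| r dr dz\<close>
(\<open>cylinder_L1_norm\<close>), and for every \<open>h > 0\<close>

  \<open>\<integral>\<integral> |u| r dr dz \<le> 2 h \<parallel>u\<parallel>\<^sub>T\<^sub>V + 4 / (\<pi> \<surd>h) \<parallel>f\<parallel>\<close>.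

The choice \<open>h = (\<parallel>f\<parallel> / \<parallel>u\<parallel>\<^sub>T\<^sub>V) powr (2/3)\<close> balances the two terms (\<open>interpolate_minimum\<close>).

The displayed bound comes from splitting \<open>r u(r)\<close> into its mean over \<open>[r, r + h]\<close> and the rest. It
is proved by duality, so that \<open>u\<close> itself is never differentiated, mollified or extended across
\<open>r = 0\<close>. The left side is the supremum of \<open>\<integral>\<integral> u r \<psi>\<close> over test functions \<open>|\<psi>| \<le> 1\<close>
(\<open>L1_bound_by_duality\<close>), and taking means of \<open>r u\<close> amounts to replacing \<open>\<psi>\<close> by the backward
mean \<open>avg h \<psi>\<close> of \<open>\<psi>\<close> over \<open>[r - h, r]\<close>.

For the rest, \<open>r (\<psi> - avg h \<psi>)\<close> is the \<open>r\<close>-derivative of an explicit function \<open>osc h \<psi>\<close> which is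
bounded by \<open>2 h\<close>. After a cutoff near \<open>r = 1\<close>, where \<open>u\<close> vanishes, it is the divergence of a
field \<open>(osc h \<psi>, 0)\<close> that competes in the definition of the total variation
(\<open>TV_controls_oscillation\<close>).

For the mean, the explicit inversion of the Abel transform writes \<open>avg h \<psi>\<close> as the transpose of
the Abel transform applied to a weight (\<open>abel_dual_weight\<close>), so that \<open>\<integral>\<integral> u r (avg h \<psi>)\<close> becomes
the pairing of \<open>f\<close> with this weight. The weight is \<open>1 / (\<pi> h)\<close> times an integral of \<open>\<psi>\<close> against
the difference between the kernel \<open>x / \<surd>(x\<^sup>2 - t\<^sup>2)\<close> and its translate by \<open>h\<close>. The kernel is
increasing in \<open>t\<close>, so this difference telescopes and its integral is of the order of the mass
\<open>O(\<surd>h)\<close> of the kernel within distance \<open>h\<close> of its singularity (\<open>dual_weight_bound\<close>).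

Test functions are finite sums of products \<open>a(r) b(z)\<close>. All constructions above act on \<open>a\<close> alone
and are linear, which reduces the smoothness of the resulting fields to one variable, and
polynomials are of this form, which gives density through the Stone-Weierstrass theorem.\<close>

section \<open>Averages over intervals of length h\<close>

text \<open>The primitive is chosen by its characterisation instead of as an integral from \<open>0\<close>: it is then
defined on both sides of \<open>0\<close>, and its linearity follows from uniqueness.\<close>

definition prim :: "(real \<Rightarrow> real) \<Rightarrow> real \<Rightarrow> real" where
  "prim a = (SOME F. (\<forall>s. (F has_real_derivative a s) (at s)) \<and> F 0 = 0)"

lemma prim_exists:
  fixes a :: "real \<Rightarrow> real"
  assumes "continuous_on UNIV a"
  shows "\<exists>F. (\<forall>s. (F has_real_derivative a s) (at s)) \<and> F 0 = 0"
proof (intro exI conjI allI)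
  fix s :: real
  have "((\<lambda>u. LBINT y=0..u. a y) has_vector_derivative a s) (at s within {min 0 s - 1 .. max 0 s + 1})"
    unfolding zero_ereal_def
    by (rule interval_integral_FTC2) (auto intro: continuous_on_subset[OF assms])
  then have "((\<lambda>u. LBINT y=0..u. a y) has_vector_derivative a s) (at s within {min 0 s - 1 <..< max 0 s + 1})"
    by (rule has_vector_derivative_within_subset) auto
  then show "((\<lambda>u. LBINT y=0..u. a y) has_real_derivative a s) (at s)"
    by (subst (asm) has_vector_derivative_within_open)
       (auto simp: has_real_derivative_iff_has_vector_derivative)
qed (simp add: zero_ereal_def)

lemma prim_deriv:
  assumes "continuous_on UNIV a"
  shows "(prim a has_real_derivative a s) (at s)" and "prim a 0 = 0"
  using someI_ex[OF prim_exists[OF assms]] unfolding prim_def by auto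

lemma prim_cont:
  assumes "continuous_on UNIV a"
  shows "continuous_on UNIV (prim a)"
  using prim_deriv(1)[OF assms] by (auto simp: continuous_on_eq_continuous_at intro: DERIV_isCont)

lemma primI:
  assumes "\<And>s. (F has_real_derivative a s) (at s)" "F 0 = 0" "continuous_on UNIV a"
  shows "prim a = F"
proof
  fix s
  have "\<And>x. ((\<lambda>s. prim a s - F s) has_real_derivative 0) (at x)"
    using DERIV_diff[OF prim_deriv(1)[OF assms(3)] assms(1)] by simp
  then have "prim a s - F s = prim a 0 - F 0"
    by (intro DERIV_isconst_all) auto
  then show "prim a s = F s" using assms prim_deriv(2) by simp
qed

lemma prim_add:
  assumes "continuous_on UNIV a" "continuous_on UNIV b"
  shows "prim (\<lambda>t. a t + b t) = (\<lambda>s. prim a s + prim b s)"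
  using assms prim_deriv by (intro primI) (auto intro!: derivative_eq_intros continuous_intros)

lemma prim_cmult:
  assumes "continuous_on UNIV a"
  shows "prim (\<lambda>t. a t * c) = (\<lambda>s. prim a s * c)"
  using assms prim_deriv by (intro primI) (auto intro!: derivative_eq_intros continuous_intros)

lemma prim_0_left:
  assumes "continuous_on UNIV a" "\<And>t. t \<le> e \<Longrightarrow> a t = 0" "0 \<le> e" "s \<le> e"
  shows "prim a s = 0"
proof -
  have 1: "prim a x = prim a e" if xe: "x < e" for x
  proof -
    obtain z where "x < z" "z < e" "prim a e - prim a x = (e - x) * a z"
      using MVT2[of x e "prim a" a] xe prim_deriv(1)[OF assms(1)] by auto
    then show ?thesis using assms(2) by auto
  qed
  have "prim a e = 0" using 1[of 0] prim_deriv(2)[OF assms(1)] assms(3) by (cases "e = 0") auto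
  then show ?thesis using 1[of s] assms(4) by (cases "s = e") auto
qed

definition avg :: "real \<Rightarrow> (real \<Rightarrow> real) \<Rightarrow> real \<Rightarrow> real" where
  "avg h a s = (prim a s - prim a (s - h)) / h"

text \<open>The closed form of \<open>\<integral>\<^sub>0\<^sup>s \<tau> (a \<tau> - avg h a \<tau>) d\<tau>\<close> for \<open>a\<close> supported in the positive half-line,
obtained by integrating by parts. Repeated primitives take the place of iterated integrals, so
that the mean value theorem suffices for all estimates.\<close>

definition osc :: "real \<Rightarrow> (real \<Rightarrow> real) \<Rightarrow> real \<Rightarrow> real" where
  "osc h a s = s * (prim a s - avg h (prim a) s) - (prim (prim a) s - avg h (prim (prim a)) s)"

lemma avg_deriv:
  assumes "continuous_on UNIV a" 
  shows "(avg h (prim a) has_real_derivative avg h a s) (at s)"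
proof -
  have 2: "((\<lambda>s. prim (prim a) (s - h)) has_real_derivative prim a (s - h)) (at s)"
    using DERIV_shift[of "prim (prim a)" "prim a (s - h)" s "- h"] prim_deriv(1)[OF prim_cont[OF assms], of "s - h"] by simp
  show ?thesis
    unfolding avg_def[abs_def]
    by (intro DERIV_cdivide DERIV_diff 2 prim_deriv(1)[OF prim_cont[OF assms]])
qed

lemma osc_deriv:
  assumes "continuous_on UNIV a"
  shows "(osc h a has_real_derivative s * (a s - avg h a s)) (at s)"
  unfolding osc_def[abs_def]
  using prim_deriv(1)[OF assms, of s] prim_deriv(1)[OF prim_cont[OF assms], of s]
    avg_deriv[OF assms, of h s] avg_deriv[OF prim_cont[OF assms], of h s]
  by (auto intro!: derivative_eq_intros simp: field_simps)

lemma avg_cont: 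
  assumes "continuous_on UNIV a" "0 < h"
  shows "continuous_on UNIV (avg h a)"
proof -
  have "continuous_on UNIV (\<lambda>s. prim a (s - h))"
    by (rule continuous_on_compose2[OF prim_cont[OF assms(1)]]) (auto intro!: continuous_on_diff)
  then show ?thesis
    unfolding avg_def[abs_def] using assms prim_cont[OF assms(1)] by (intro continuous_on_divide continuous_on_diff continuous_on_const) auto
qed

lemma osc_add:
  assumes "continuous_on UNIV a" "continuous_on UNIV b"
  shows "osc h (\<lambda>t. a t + b t) s = osc h a s + osc h b s" "avg h (\<lambda>t. a t + b t) s = avg h a s + avg h b s"
  using assms by (simp_all add: osc_def avg_def prim_add prim_cont algebra_simps add_divide_distrib diff_divide_distrib)

lemma osc_cmult:
  assumes "continuous_on UNIV a"
  shows "osc h (\<lambda>t. a t * c) s = osc h a s * c" "avg h (\<lambda>t. a t * c) s = avg h a s * c"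
  unfolding osc_def avg_def prim_cmult[OF assms] prim_cmult[OF prim_cont[OF assms]]
    prim_cmult[OF prim_cont[OF prim_cont[OF assms]]]
  by (simp_all add: algebra_simps add_divide_distrib diff_divide_distrib)

lemma osc_0_left:
  assumes "continuous_on UNIV a" "\<And>t. t \<le> e \<Longrightarrow> a t = 0" "0 \<le> e" "s \<le> e" "0 < h"
  shows "osc h a s = 0"
proof -
  have 1: "prim a s = 0" if "s \<le> e" for s using assms that by (intro prim_0_left[of a e])
  have 2: "prim (prim a) s = 0" if "s \<le> e" for s using assms that by (intro prim_0_left[of "prim a" e] prim_cont 1)
  have 3: "prim (prim (prim a)) s = 0" if "s \<le> e" for s using assms that by (intro prim_0_left[of "prim (prim a)" e] prim_cont 2)
  show ?thesis using assms by (simp add: osc_def avg_def 1 2 3)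
qed

lemma avg_eq_value:
  assumes "continuous_on UNIV a" "0 < h"
  obtains z where "s - h < z" "z < s" "avg h a s = a z"
proof -
  obtain z where "s - h < z" "z < s" "prim a s - prim a (s - h) = (s - (s - h)) * a z"
    using MVT2[of "s - h" s "prim a" a] prim_deriv(1)[OF assms(1)] assms(2) by auto
  then show ?thesis using that assms(2) by (auto simp: avg_def)
qed

text \<open>Both terms of \<open>osc h a s = s Y s - Z s\<close> are small: \<open>Y\<close> is the deviation of the 1-Lipschitz
function \<open>prim a\<close> from its mean over an interval of length \<open>h\<close>, hence at most \<open>h\<close>, and \<open>Z\<close> is the
primitive of \<open>Y\<close>.\<close>

lemma osc_bound:
  assumes a: "continuous_on UNIV a" "\<And>t. t \<le> 0 \<Longrightarrow> a t = 0" "\<And>t. \<bar>a t\<bar> \<le> 1" and h: "0 < h" and s: "0 \<le> s" "s \<le> 1"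
  shows "\<bar>osc h a s\<bar> \<le> 2 * h"
proof -
  have lip: "\<bar>prim a x - prim a y\<bar> \<le> x - y" if yx: "y < x" for x y
  proof -
    obtain z where "prim a x - prim a y = (x - y) * a z"
      using MVT2[of y x "prim a" a] yx prim_deriv(1)[OF a(1)] by auto
    then show ?thesis using a(3)[of z] yx by (simp add: abs_mult mult_left_le)
  qed
  have Y: "\<bar>prim a x - avg h (prim a) x\<bar> \<le> h" for x
  proof -
    obtain z where "x - h < z" "z < x" "avg h (prim a) x = prim a z"
      using avg_eq_value[OF prim_cont[OF a(1)] h] by blast
    then show ?thesis using lip[of z x] by auto
  qed
  \<comment> \<open>\<open>Z\<close> is the second term of \<open>osc\<close>; its derivative is the deviation bounded in \<open>Y\<close>.\<close>
  define Z where "Z x = prim (prim a) x - avg h (prim (prim a)) x" for x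
  have Zd: "(Z has_real_derivative prim a x - avg h (prim a) x) (at x)" for x
    unfolding Z_def[abs_def] using prim_deriv(1)[OF prim_cont[OF a(1)], of x] avg_deriv[OF prim_cont[OF a(1)], of h x]
    by (auto intro!: derivative_eq_intros)
  have 1: "prim a s = 0" if "s \<le> 0" for s using a that by (intro prim_0_left[of a 0]) auto
  have 2: "prim (prim a) s = 0" if "s \<le> 0" for s using a that by (intro prim_0_left[of "prim a" 0] prim_cont 1) auto
  have 3: "prim (prim (prim a)) s = 0" if "s \<le> 0" for s using a that by (intro prim_0_left[of "prim (prim a)" 0] prim_cont 2) auto
  have Z0: "Z 0 = 0" using h by (simp add: Z_def avg_def 2 3)
  have Z: "\<bar>Z s\<bar> \<le> h * 1"
  proof (cases "s = 0")
    case False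
    then obtain z where z: "Z s - Z 0 = (s - 0) * (prim a z - avg h (prim a) z)"
      using MVT2[of 0 s Z "\<lambda>x. prim a x - avg h (prim a) x"] Zd s by auto
    have "\<bar>Z s\<bar> = s * \<bar>prim a z - avg h (prim a) z\<bar>"
      using z s by (simp add: Z0 abs_mult)
    also have "\<dots> \<le> 1 * h" using Y[of z] s by (intro mult_mono) auto
    finally show ?thesis by simp
  qed (use Z0 h in auto)
  have "\<bar>s * (prim a s - avg h (prim a) s)\<bar> \<le> 1 * h"
    unfolding abs_mult using Y[of s] s by (intro mult_mono) auto
  with Z show ?thesis unfolding osc_def Z_def by (auto simp: abs_le_iff)
qed

section \<open>Test functions\<close>

text \<open>The second argument names the first partial derivative, the only one that enters the divergence
of a field with vanishing second component.\<close>

definition C1_on_plane :: "(real \<times> real \<Rightarrow> real) \<Rightarrow> (real \<times> real \<Rightarrow> real) \<Rightarrow> bool" where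
  "C1_on_plane F Fr \<longleftrightarrow> continuous_on UNIV Fr \<and> (\<exists>Fz. continuous_on UNIV Fz \<and>
     (\<forall>p. (F has_derivative (\<lambda>h. Fr p * fst h + Fz p * snd h)) (at p)))"

definition C1_real :: "(real \<Rightarrow> real) \<Rightarrow> bool" where
  "C1_real b \<longleftrightarrow> (\<exists>b'. continuous_on UNIV b' \<and> (\<forall>s. (b has_real_derivative b' s) (at s)))"

text \<open>Only \<open>b\<close> has to be differentiable: \<open>osc h\<close> acts on \<open>a\<close> and gains a derivative.\<close>

inductive_set tensors :: "(real \<times> real \<Rightarrow> real) set" where
  prod: "continuous_on UNIV a \<Longrightarrow> C1_real b \<Longrightarrow> (\<lambda>p. a (fst p) * b (snd p)) \<in> tensors"
| add: "f \<in> tensors \<Longrightarrow> g \<in> tensors \<Longrightarrow> (\<lambda>p. f p + g p) \<in> tensors"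

lemma C1_real_cont: "C1_real b \<Longrightarrow> continuous_on UNIV b"
  unfolding C1_real_def by (metis DERIV_isCont continuous_on_eq_continuous_at open_UNIV)

lemma C1_real_mult:
  assumes "C1_real a" "C1_real b" shows "C1_real (\<lambda>s. a s * b s)"
proof -
  obtain a' b' where *: "continuous_on UNIV a'" "\<And>s. (a has_real_derivative a' s) (at s)"
    "continuous_on UNIV b'" "\<And>s. (b has_real_derivative b' s) (at s)"
    using assms unfolding C1_real_def by metis
  show ?thesis unfolding C1_real_def
    by (rule exI[of _ "\<lambda>s. a' s * b s + b' s * a s"])
       (auto intro!: continuous_on_add continuous_on_mult * C1_real_cont[OF assms(1)] C1_real_cont[OF assms(2)] derivative_eq_intros)
qed

lemma C1_real_id: "C1_real (\<lambda>s. s)" 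
  unfolding C1_real_def by (rule exI[of _ "\<lambda>s. 1"]) simp

lemma C1_real_const: "C1_real (\<lambda>s. c)"
  unfolding C1_real_def by (rule exI[of _ "\<lambda>s. 0"]) simp

lemma tensors_mult:
  assumes "f \<in> tensors" "g \<in> tensors" shows "(\<lambda>p. f p * g p) \<in> tensors"
  using assms(1)
proof induction
  case (prod a b)
  from assms(2) show ?case
  proof induction
    case (prod c d)
    have "(\<lambda>p. (\<lambda>s. a s * c s) (fst p) * (\<lambda>s. b s * d s) (snd p)) \<in> tensors"
      using prod \<open>continuous_on UNIV a\<close> \<open>C1_real b\<close> 
      by (intro tensors.prod C1_real_mult continuous_on_mult)
    then show ?case by (simp add: mult_ac)
  next
    case (add f g)
    then show ?case using tensors.add[OF add.IH] by (simp add: algebra_simps)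
  qed
next
  case (add f g)
  then show ?case using tensors.add[OF add.IH] by (simp add: algebra_simps)
qed

lemma tensors_polynomial:
  assumes "real_polynomial_function p" shows "p \<in> tensors"
  using assms
proof induction
  case (linear f)
  then interpret bounded_linear f .
  have eq: "f q = fst q * f (1, 0) + 1 * (f (0, 1) * snd q)" for q
  proof -
    have "f q = f (fst q *\<^sub>R (1, 0) + snd q *\<^sub>R (0, 1))" by simp
    also have "\<dots> = f (fst q *\<^sub>R (1, 0)) + f (snd q *\<^sub>R (0, 1))" by (rule add)
    also have "\<dots> = fst q * f (1, 0) + 1 * (f (0, 1) * snd q)"
      by (simp only: scaleR real_scaleR_def mult_1 mult.commute)
    finally show ?thesis .
  qed
  have "C1_real (\<lambda>s. f (0, 1) * s)" 
    using C1_real_mult[OF C1_real_const C1_real_id] .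
  then have "(\<lambda>q. 1 * (f (0, 1) * snd q)) \<in> tensors"
    using tensors.prod[of "\<lambda>s. 1" "\<lambda>s. f (0, 1) * s"] by (simp only: continuous_on_const)
  moreover have "(\<lambda>q. fst q * f (1, 0)) \<in> tensors"
    using tensors.prod[of "\<lambda>s. s" "\<lambda>s. f (1, 0)"] by (simp only: continuous_on_id C1_real_const)
  ultimately have "(\<lambda>q. fst q * f (1, 0) + 1 * (f (0, 1) * snd q)) \<in> tensors"
    using tensors.add by blast
  then show ?case unfolding eq[symmetric] .
next
  case (const c)
  show ?case using tensors.prod[of "\<lambda>s. 1" "\<lambda>s. c"] by (simp add: C1_real_const)
qed (auto intro: tensors.add tensors_mult)

lemma tensors_cont:
  assumes "f \<in> tensors" shows "continuous_on UNIV f"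
  using assms
proof induction
  case (prod a b)
  then show ?case
    by (intro continuous_on_mult continuous_on_compose2[of UNIV a UNIV fst]
        continuous_on_compose2[OF C1_real_cont, of b UNIV snd] continuous_on_fst continuous_on_snd continuous_on_id) auto
qed (auto intro: continuous_on_add)

lemma tensors_cont_slice: "f \<in> tensors \<Longrightarrow> continuous_on UNIV (\<lambda>t. f (t, z))"
  by (rule continuous_on_compose2[OF tensors_cont, of f UNIV]) (auto intro!: continuous_intros)

lemma C1_on_plane_add:
  assumes "C1_on_plane F Fr" "C1_on_plane G Gr"
  shows "C1_on_plane (\<lambda>p. F p + G p) (\<lambda>p. Fr p + Gr p)"
proof -
  obtain Fz where F: "continuous_on UNIV Fz" "continuous_on UNIV Fr"
      "\<And>p. (F has_derivative (\<lambda>h. Fr p * fst h + Fz p * snd h)) (at p)"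
    using assms(1) unfolding C1_on_plane_def by blast
  obtain Gz where G: "continuous_on UNIV Gz" "continuous_on UNIV Gr"
      "\<And>p. (G has_derivative (\<lambda>h. Gr p * fst h + Gz p * snd h)) (at p)"
    using assms(2) unfolding C1_on_plane_def by blast
  show ?thesis unfolding C1_on_plane_def
  proof (intro conjI exI[of _ "\<lambda>p. Fz p + Gz p"] allI)
    fix p
    show "((\<lambda>p. F p + G p) has_derivative (\<lambda>h. (Fr p + Gr p) * fst h + (Fz p + Gz p) * snd h)) (at p)"
      using has_derivative_add[OF F(3)[of p] G(3)[of p]] by (simp add: algebra_simps)
  qed (intro continuous_on_add F G)+
qed

lemma C1_on_plane_prod:
  assumes A: "\<And>s. (A has_real_derivative A' s) (at s)" "continuous_on UNIV A'" and b: "C1_real b"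
  shows "C1_on_plane (\<lambda>p. A (fst p) * b (snd p)) (\<lambda>p. A' (fst p) * b (snd p))"
proof -
  obtain b' where b': "continuous_on UNIV b'" "\<And>s. (b has_real_derivative b' s) (at s)"
    using b unfolding C1_real_def by blast
  have Ac: "continuous_on UNIV A"
    using A(1) by (metis DERIV_isCont continuous_on_eq_continuous_at open_UNIV)
  have c: "continuous_on UNIV (\<lambda>p::real\<times>real. g (fst p))" "continuous_on UNIV (\<lambda>p::real\<times>real. g (snd p))"
    if "continuous_on UNIV g" for g :: "real \<Rightarrow> real"
    by (rule continuous_on_compose2[OF that]; auto intro!: continuous_intros)+
  show ?thesis unfolding C1_on_plane_def
  proof (intro conjI exI[of _ "\<lambda>p. A (fst p) * b' (snd p)"] allI)
    fix p :: "real \<times> real"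
    have 1: "((\<lambda>p. A (fst p)) has_derivative (\<lambda>h. A' (fst p) * fst h)) (at p)"
      by (rule has_derivative_compose[where f=fst and g=A, unfolded o_def])
         (auto intro!: derivative_eq_intros A(1)[unfolded has_field_derivative_def])
    have 2: "((\<lambda>p. b (snd p)) has_derivative (\<lambda>h. b' (snd p) * snd h)) (at p)"
      by (rule has_derivative_compose[where f=snd and g=b, unfolded o_def])
         (auto intro!: derivative_eq_intros b'(2)[unfolded has_field_derivative_def])
    show "((\<lambda>p. A (fst p) * b (snd p)) has_derivative
         (\<lambda>h. A' (fst p) * b (snd p) * fst h + A (fst p) * b' (snd p) * snd h)) (at p)"
      using has_derivative_mult[OF 1 2] by (simp add: algebra_simps)
  qed (intro continuous_on_mult c A b' C1_real_cont[OF b] Ac)+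
qed

text \<open>Linearity of \<open>osc h\<close> and \<open>avg h\<close> in the function reduces the claim to a single product
\<open>a(r) b(z)\<close>, on which they act through \<open>a\<close>, so that only derivatives in one variable occur.
The factor \<open>\<eta>\<close> leaves room for a cutoff in \<open>r\<close>.\<close>

lemma tensors_osc_C1:
  assumes "f \<in> tensors" and h: "0 < h"
    and \<eta>: "continuous_on UNIV \<eta>'" "\<And>s. (\<eta> has_real_derivative \<eta>' s) (at s)"
  shows "C1_on_plane (\<lambda>p. \<eta> (fst p) * osc h (\<lambda>t. f (t, snd p)) (fst p))
    (\<lambda>p. \<eta>' (fst p) * osc h (\<lambda>t. f (t, snd p)) (fst p) + \<eta> (fst p) * (fst p * (f p - avg h (\<lambda>t. f (t, snd p)) (fst p))))"
  using assms(1)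
proof induction
  case (prod a b)
  have \<eta>c: "continuous_on UNIV \<eta>"
    using \<eta>(2) by (metis DERIV_isCont continuous_on_eq_continuous_at open_UNIV)
  have oc: "continuous_on UNIV (osc h a)"
    using osc_deriv[OF prod(1)] by (metis DERIV_isCont continuous_on_eq_continuous_at open_UNIV)
  have "C1_on_plane (\<lambda>p. (\<lambda>s. \<eta> s * osc h a s) (fst p) * b (snd p))
     (\<lambda>p. (\<lambda>s. \<eta>' s * osc h a s + \<eta> s * (s * (a s - avg h a s))) (fst p) * b (snd p))"
    by (rule C1_on_plane_prod)
       (auto intro!: derivative_eq_intros osc_deriv \<eta> prod continuous_on_add continuous_on_mult continuous_on_diff continuous_on_id \<eta>c oc avg_cont h)
  then show ?case
    by (simp add: osc_cmult prod algebra_simps)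
next
  case (add f g)
  show ?case
    using C1_on_plane_add[OF add.IH] 
    by (simp add: osc_add tensors_cont_slice add.hyps algebra_simps)
qed

text \<open>A continuously differentiable step from \<open>0\<close> (for \<open>t \<le> 0\<close>) to \<open>1\<close> (for \<open>t \<ge> 1\<close>).\<close>

definition smoothstep :: "real \<Rightarrow> real" where
  "smoothstep t = (max 0 t)\<^sup>2 / ((max 0 t)\<^sup>2 + (max 0 (1 - t))\<^sup>2)"

lemma smoothstep_denom: "0 < (max 0 t)\<^sup>2 + (max 0 (1 - t))\<^sup>2" for t :: real
  by (cases "0 < t") (auto intro: add_pos_nonneg add_nonneg_pos)

lemma smoothstep_simps:
  "t \<le> 0 \<Longrightarrow> smoothstep t = 0" "1 \<le> t \<Longrightarrow> smoothstep t = 1" "0 \<le> smoothstep t" "smoothstep t \<le> 1"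
proof -
  show "t \<le> 0 \<Longrightarrow> smoothstep t = 0" "1 \<le> t \<Longrightarrow> smoothstep t = 1" by (simp_all add: smoothstep_def)
  show "0 \<le> smoothstep t" by (simp add: smoothstep_def)
  show "smoothstep t \<le> 1" unfolding smoothstep_def using smoothstep_denom[of t] by (subst divide_le_eq_1_pos) auto
qed

lemma pos_square_deriv: "((\<lambda>t. (max 0 t)\<^sup>2) has_real_derivative 2 * max 0 x) (at x)"
proof -
  consider "x < 0" | "x > 0" | "x = 0" by linarith
  then show ?thesis
  proof cases
    case 1
    have "((\<lambda>t. 0) has_real_derivative 0) (at x)" by simp
    then have "((\<lambda>t. (max 0 t)\<^sup>2) has_real_derivative 0) (at x)"
      by (rule has_field_derivative_transform_within_open[of _ _ _ "{..<0}"]) (use 1 in auto)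
    then show ?thesis using 1 by simp
  next
    case 2
    have "((\<lambda>t. t\<^sup>2) has_real_derivative 2 * x) (at x)" by (auto intro!: derivative_eq_intros)
    then have "((\<lambda>t. (max 0 t)\<^sup>2) has_real_derivative 2 * x) (at x)"
      by (rule has_field_derivative_transform_within_open[of _ _ _ "{0<..}"]) (use 2 in auto)
    then show ?thesis using 2 by simp
  next
    case 3
    have "(\<lambda>h::real. (max 0 h)\<^sup>2 / h) \<midarrow>0\<rightarrow> 0"
    proof (rule Lim_null_comparison[where g="\<lambda>h. \<bar>h\<bar>"])
      show "\<forall>\<^sub>F h in at 0. norm ((max 0 h)\<^sup>2 / h) \<le> \<bar>h::real\<bar>"
        by (auto simp: max_def power2_eq_square intro!: always_eventually)
    qed (auto intro!: tendsto_eq_intros)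
    then show ?thesis unfolding 3 DERIV_def by simp
  qed
qed

lemma smoothstep_C1: 
  obtains S' where "continuous_on UNIV S'" "\<And>t. (smoothstep has_real_derivative S' t) (at t)"
proof
  let ?D = "\<lambda>t::real. (max 0 t)\<^sup>2 + (max 0 (1 - t))\<^sup>2"
  let ?D' = "\<lambda>t::real. 2 * max 0 t - 2 * max 0 (1 - t)"
  have D0: "?D t \<noteq> 0" for t using smoothstep_denom[of t] by linarith
  show "continuous_on UNIV (\<lambda>t. (2 * max 0 t * ?D t - (max 0 t)\<^sup>2 * ?D' t) / (?D t * ?D t))"
    using D0 by (intro continuous_intros) auto
  fix t
  have "((\<lambda>t. (max 0 (1 - t))\<^sup>2) has_real_derivative 2 * max 0 (1 - t) * (- 1)) (at t)"
    by (rule DERIV_chain2[of "\<lambda>t. (max 0 t)\<^sup>2" _ "\<lambda>t. 1 - t"]) (auto intro!: pos_square_deriv derivative_eq_intros)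
  then have "(?D has_real_derivative ?D' t) (at t)"
    using DERIV_add[OF pos_square_deriv] by fastforce
  then show "(smoothstep has_real_derivative (2 * max 0 t * ?D t - (max 0 t)\<^sup>2 * ?D' t) / (?D t * ?D t)) (at t)"
    unfolding smoothstep_def[abs_def] by (intro DERIV_divide pos_square_deriv D0)
qed

lemma smoothstep_affine_C1:
  obtains S' where "continuous_on UNIV S'" "\<And>t. ((\<lambda>t. smoothstep (c * t + d)) has_real_derivative S' t) (at t)"
proof -
  obtain S' where S: "continuous_on UNIV S'" "\<And>t. (smoothstep has_real_derivative S' t) (at t)"
    using smoothstep_C1 by blast
  show thesis
  proof
    show "continuous_on UNIV (\<lambda>t. S' (c * t + d) * c)"
      by (intro continuous_on_mult continuous_on_compose2[OF S(1)]) (auto intro!: continuous_intros)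
    show "((\<lambda>t. smoothstep (c * t + d)) has_real_derivative S' (c * t + d) * c) (at t)" for t
      by (rule DERIV_chain2[of smoothstep]) (auto intro!: S derivative_eq_intros)
  qed
qed

lemma C1_real_smoothstep: "C1_real (\<lambda>t. smoothstep (c * t + d))"
proof -
  obtain S' where "continuous_on UNIV S'" "\<And>t. ((\<lambda>t. smoothstep (c * t + d)) has_real_derivative S' t) (at t)"
    using smoothstep_affine_C1 by blast
  then show ?thesis unfolding C1_real_def by (intro exI[of _ S']) simp
qed

lemma interior_Omega: "interior Omega = {0<..<1} \<times> {-1<..<1}"
  by (simp add: Omega_def interior_Times interior_atLeastAtMost_real)

text \<open>The uniform margin \<open>e\<close> keeps the closure of the support inside the open rectangle and makes
\<open>\<psi>\<close> vanish for \<open>r \<le> 0\<close>, so that backward means need no special treatment at the axis.\<close>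

definition admissible :: "(real \<times> real \<Rightarrow> real) \<Rightarrow> bool" where
  "admissible \<psi> \<longleftrightarrow> \<psi> \<in> tensors \<and> (\<forall>p. \<bar>\<psi> p\<bar> \<le> 1) \<and>
     (\<exists>e>0. \<forall>p. \<psi> p \<noteq> 0 \<longrightarrow> e \<le> fst p \<and> fst p \<le> 1 - e \<and> \<bar>snd p\<bar> \<le> 1 - e)"

text \<open>The cutoffs with \<open>m \<rightarrow> \<infinity>\<close> exhaust the open rectangle. They are products of a function of \<open>r\<close> and
a function of \<open>z\<close>, hence compatible with \<open>tensors\<close>.\<close>

lemma rectangle_cutoff:
  fixes m :: real
  assumes "0 < m"
  defines "\<kappa> \<equiv> \<lambda>p. (smoothstep (m * fst p + (-1)) * smoothstep (-m * fst p + (m-1))) *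
                   (smoothstep (m * snd p + (m-1)) * smoothstep (-m * snd p + (m-1)))"
  shows "\<kappa> \<in> tensors" "0 \<le> \<kappa> p" "\<kappa> p \<le> 1"
    "\<kappa> p \<noteq> 0 \<Longrightarrow> 1/m \<le> fst p \<and> fst p \<le> 1 - 1/m \<and> \<bar>snd p\<bar> \<le> 1 - 1/m"
    "2 \<le> m * fst p \<Longrightarrow> 2 \<le> m * (1 - fst p) \<Longrightarrow> 2 \<le> m * (1 - \<bar>snd p\<bar>) \<Longrightarrow> \<kappa> p = 1"
proof -
  show "\<kappa> \<in> tensors" unfolding \<kappa>_def
    by (rule tensors.prod[of "\<lambda>r. smoothstep (m * r + (-1)) * smoothstep (-m * r + (m-1))"
          "\<lambda>z. smoothstep (m * z + (m-1)) * smoothstep (-m * z + (m-1))"])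
       (intro C1_real_cont C1_real_mult C1_real_smoothstep)+
  show "0 \<le> \<kappa> p" unfolding \<kappa>_def by (intro mult_nonneg_nonneg smoothstep_simps)
  show "\<kappa> p \<le> 1" unfolding \<kappa>_def by (intro mult_le_one mult_nonneg_nonneg smoothstep_simps)
  show "1/m \<le> fst p \<and> fst p \<le> 1 - 1/m \<and> \<bar>snd p\<bar> \<le> 1 - 1/m" if "\<kappa> p \<noteq> 0"
  proof -
    have "0 < m * fst p + (-1)" "0 < -m * fst p + (m-1)" "0 < m * snd p + (m-1)" "0 < -m * snd p + (m-1)"
      using that smoothstep_simps(1) by (auto simp: \<kappa>_def not_le[symmetric] simp del: mult_minus_left)
    then show ?thesis using assms by (auto simp: field_simps abs_le_iff)
  qed
  show "\<kappa> p = 1" if "2 \<le> m * fst p" "2 \<le> m * (1 - fst p)" "2 \<le> m * (1 - \<bar>snd p\<bar>)"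
  proof -
    have "m * snd p \<le> m * \<bar>snd p\<bar>" "m * (- snd p) \<le> m * \<bar>snd p\<bar>"
      using assms by (intro mult_left_mono; simp)+
    then have "1 \<le> m * fst p + (-1)" "1 \<le> -m * fst p + (m-1)" "1 \<le> m * snd p + (m-1)" "1 \<le> -m * snd p + (m-1)"
      using that unfolding right_diff_distrib mult_minus_left mult_minus_right mult_1_right by linarith+
    then show ?thesis unfolding \<kappa>_def by (simp only: smoothstep_simps mult_1)
  qed
qed

text \<open>A Lebesgue measurable function is an almost everywhere limit of continuous functions; these are
clamped to \<open>[-1, 1]\<close>, replaced by polynomials on the compact rectangle, cut off near its boundary,
and rescaled to repair the error of the polynomial approximation in the bound by 1.\<close>

lemma admissible_dense:
  fixes s :: "real \<times> real \<Rightarrow> real"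
  assumes [measurable]: "s \<in> borel_measurable borel" and s1: "\<And>p. \<bar>s p\<bar> \<le> 1"
  obtains \<psi> where "\<And>n::nat. admissible (\<psi> n)"
    and "AE p in lborel. p \<in> interior Omega \<longrightarrow> (\<lambda>n. \<psi> n p) \<longlonglongrightarrow> s p"
proof -
  have "s measurable_on UNIV"
    by (rule lebesgue_measurable_imp_measurable_on) (auto intro!: measurable_completion)
  then obtain N G where N: "negligible N" "\<And>n. continuous_on UNIV (G n)"
    "\<And>p. p \<notin> N \<Longrightarrow> (\<lambda>n. G n p) \<longlonglongrightarrow> s p"
    unfolding measurable_on_def by auto
  define c where "c n p = max (-1) (min 1 (G n p))" for n :: nat and p
  have c: "\<bar>c n p\<bar> \<le> 1" "continuous_on UNIV (c n)" for n p
    unfolding c_def using N(2) by (auto intro!: continuous_intros)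
  have clim: "(\<lambda>n. c n p) \<longlonglongrightarrow> s p" if "p \<notin> N" for p
  proof -
    have "(\<lambda>n. c n p) \<longlonglongrightarrow> max (-1) (min 1 (s p))"
      unfolding c_def by (intro tendsto_intros N that)
    then show ?thesis using s1[of p] by (simp add: abs_le_iff min_def max_def split: if_splits)
  qed
  have "\<exists>g. real_polynomial_function g \<and> (\<forall>p\<in>Omega. \<bar>c n p - g p\<bar> < inverse (Suc n))" for n
  proof -
    have "compact Omega" by (simp add: Omega_def compact_Times)
    then obtain g where "real_polynomial_function g" "\<And>p. p \<in> Omega \<Longrightarrow> \<bar>c n p - g p\<bar> < inverse (Suc n)"
      using Stone_Weierstrass_real_polynomial_function[of Omega "c n" "inverse (Suc n)"]
        continuous_on_subset[OF c(2)] by auto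
    then show ?thesis by auto
  qed
  then obtain P where P: "\<And>n. real_polynomial_function (P n)"
    "\<And>n p. p \<in> Omega \<Longrightarrow> \<bar>c n p - P n p\<bar> < inverse (Suc n)" by metis
  define \<kappa> where "\<kappa> m p = (smoothstep (m * fst p + (-1)) * smoothstep (-m * fst p + (m-1))) *
                   (smoothstep (m * snd p + (m-1)) * smoothstep (-m * snd p + (m-1)))" for m p
  note \<kappa> = rectangle_cutoff[folded \<kappa>_def]
  define \<psi> where "\<psi> n p = P n p * \<kappa> (real (Suc n)) p * (1 / (1 + inverse (Suc n)))" for n p
  have "admissible (\<psi> n)" for n
    unfolding admissible_def
  proof (intro conjI exI[of _ "1 / real (Suc n)"] allI impI)
    have "(\<lambda>p. (1 / (1 + inverse (Suc n)))) \<in> tensors"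
      using tensors_polynomial[OF real_polynomial_function.intros(2)] .
    then show "\<psi> n \<in> tensors" unfolding \<psi>_def
      by (intro tensors_mult tensors_polynomial P \<kappa>(1)) auto
    fix p
    show "\<bar>\<psi> n p\<bar> \<le> 1"
    proof (cases "\<kappa> (real (Suc n)) p = 0")
      case False
      have "0 \<le> 1 / real (Suc n)" by simp
      moreover have "1 / real (Suc n) \<le> fst p \<and> fst p \<le> 1 - 1 / real (Suc n) \<and> \<bar>snd p\<bar> \<le> 1 - 1 / real (Suc n)"
        using \<kappa>(4)[OF _ False] by simp
      ultimately have "0 \<le> fst p" "fst p \<le> 1" "-1 \<le> snd p" "snd p \<le> 1" by linarith+
      then have "p \<in> Omega" by (simp add: Omega_def mem_Times_iff)
      then have "\<bar>P n p\<bar> \<le> 1 + inverse (Suc n)" using P(2)[of p n] c(1)[of n p] by linarith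
      moreover have "0 < 1 + inverse (real (Suc n))" by (simp add: add_pos_pos)
      moreover have "\<bar>P n p\<bar> * \<kappa> (real (Suc n)) p \<le> \<bar>P n p\<bar>" using \<kappa>(3)[of "Suc n" p] by (simp add: mult_left_le)
      moreover have "\<bar>\<psi> n p\<bar> = \<bar>P n p\<bar> * \<kappa> (real (Suc n)) p / (1 + inverse (Suc n))"
        using \<kappa>(2)[of "Suc n" p] by (simp add: \<psi>_def abs_mult)
      ultimately show ?thesis by (simp only: divide_le_eq_1_pos) 
    qed (simp add: \<psi>_def)
    assume "\<psi> n p \<noteq> 0"
    then show "1 / real (Suc n) \<le> fst p" "fst p \<le> 1 - 1 / real (Suc n)" "\<bar>snd p\<bar> \<le> 1 - 1 / real (Suc n)"
      using \<kappa>(4)[of "Suc n" p] by (auto simp: \<psi>_def)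
  qed simp
  moreover have "(\<lambda>n. \<psi> n p) \<longlonglongrightarrow> s p" if p: "p \<in> interior Omega" "p \<notin> N" for p
  proof -
    have pO: "0 < fst p" "fst p < 1" "\<bar>snd p\<bar> < 1" "p \<in> Omega"
      using p interior_subset[of Omega] unfolding interior_Omega by auto
    have 1: "(\<lambda>n. inverse (real (Suc n))) \<longlonglongrightarrow> 0" by (rule LIMSEQ_inverse_real_of_nat)
    have "(\<lambda>n. c n p - P n p) \<longlonglongrightarrow> 0"
      by (rule Lim_null_comparison[OF _ 1]) (use P(2)[OF pO(4)] in \<open>auto intro!: always_eventually less_imp_le\<close>)
    from tendsto_diff[OF clim[OF p(2)] this] have Plim: "(\<lambda>n. P n p) \<longlonglongrightarrow> s p" by simp
    have ev: "\<forall>\<^sub>F n in sequentially. 2 \<le> real (Suc n) * x" if "0 < x" for x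
    proof -
      obtain n0 where "2 / x < real n0" using reals_Archimedean2 by blast
      then have "2 \<le> real (Suc n) * x" if "n \<ge> n0" for n
        using that \<open>0 < x\<close> by (simp add: divide_less_eq) (smt (verit) mult_right_mono of_nat_mono)
      then show ?thesis by (auto simp: eventually_sequentially)
    qed
    have "\<forall>\<^sub>F n in sequentially. \<kappa> (real (Suc n)) p = 1"
    proof -
      have "\<forall>\<^sub>F n in sequentially. 2 \<le> real (Suc n) * (1 - fst p)"
        "\<forall>\<^sub>F n in sequentially. 2 \<le> real (Suc n) * (1 - \<bar>snd p\<bar>)" using pO by (intro ev; simp)+
      with ev[OF pO(1)] show ?thesis by eventually_elim (rule \<kappa>(5), simp_all)
    qed
    then have "(\<lambda>n. \<kappa> (real (Suc n)) p) \<longlonglongrightarrow> 1" by (rule tendsto_eventually)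
    from tendsto_mult[OF tendsto_mult[OF Plim this] tendsto_divide[OF tendsto_const[of 1] tendsto_add[OF tendsto_const[of 1] 1]]]
    show ?thesis unfolding \<psi>_def by simp
  qed
  moreover have N_AE: "AE p in lborel. p \<notin> N"
    using N(1) by (intro AE_completion_iff[THEN iffD1, OF AE_not_in]) (simp add: negligible_iff_null_sets)
  moreover have "AE p in lborel. p \<in> interior Omega \<longrightarrow> (\<lambda>n. \<psi> n p) \<longlonglongrightarrow> s p"
    using N_AE by eventually_elim (use calculation in blast)
  ultimately show thesis by (intro that[of \<psi>])
qed

lemma admissible_measurable: "admissible \<psi> \<Longrightarrow> \<psi> \<in> borel_measurable borel"
  by (auto simp: admissible_def intro: borel_measurable_continuous_onI tensors_cont)

text \<open>Dominated convergence along admissible functions tending to the sign of \<open>g\<close>.\<close>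

lemma L1_bound_by_duality:
  fixes g :: "real \<times> real \<Rightarrow> real"
  assumes g: "integrable lborel g" and g0: "\<And>p. p \<notin> interior Omega \<Longrightarrow> g p = 0"
    and K: "\<And>\<psi>. admissible \<psi> \<Longrightarrow> (\<integral>p. g p * \<psi> p \<partial>lborel) \<le> K"
  shows "(\<integral>p. \<bar>g p\<bar> \<partial>lborel) \<le> K"
proof -
  have [measurable]: "g \<in> borel_measurable borel" using g by auto
  have "(\<lambda>p. sgn (g p)) \<in> borel_measurable borel" by measurable
  then obtain \<psi> where \<psi>: "\<And>n::nat. admissible (\<psi> n)"
    "AE p in lborel. p \<in> interior Omega \<longrightarrow> (\<lambda>n. \<psi> n p) \<longlonglongrightarrow> sgn (g p)"
    by (rule admissible_dense) (auto simp: sgn_if)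
  note [measurable] = admissible_measurable[OF \<psi>(1)]
  have "(\<lambda>n. \<integral>p. g p * \<psi> n p \<partial>lborel) \<longlonglongrightarrow> (\<integral>p. \<bar>g p\<bar> \<partial>lborel)"
  proof (rule integral_dominated_convergence[where w="\<lambda>p. \<bar>g p\<bar>"])
    show "AE p in lborel. (\<lambda>n. g p * \<psi> n p) \<longlonglongrightarrow> \<bar>g p\<bar>"
      using \<psi>(2)
    proof eventually_elim
      case (elim p)
      show ?case
      proof (cases "p \<in> interior Omega")
        case True
        with elim have "(\<lambda>n. \<psi> n p) \<longlonglongrightarrow> sgn (g p)" by blast
        then show ?thesis unfolding abs_sgn by (intro tendsto_mult tendsto_const)
      qed (simp add: g0)
    qed
    show "AE p in lborel. norm (g p * \<psi> n p) \<le> \<bar>g p\<bar>" for n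
      using \<psi>(1)[of n] by (auto simp: admissible_def abs_mult intro!: mult_left_le)
  qed (use g in auto)
  then show ?thesis by (rule LIMSEQ_le_const2) (use K \<psi>(1) in auto)
qed

section \<open>Null sets and iterated integrals\<close>

text \<open>Lebesgue measure on the plane is not the product of the complete measures on the line, whereas
\<open>lborel\<close> is compatible with products; integrals are therefore moved there. Measurability of \<open>f\<close> itself comes from completeness.\<close>

lemma lebesgue_eq_AE_borel:
  fixes f g :: "'a::euclidean_space \<Rightarrow> real"
  assumes ae: "AE x in lborel. f x = g x" and g [measurable]: "g \<in> borel_measurable borel"
  shows "f \<in> borel_measurable lebesgue" "integral\<^sup>L lebesgue f = integral\<^sup>L lborel g"
proof -
  have ae': "AE x in lebesgue. f x = g x" using ae by (rule AE_completion)
  show f: "f \<in> borel_measurable lebesgue"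
  proof (rule borel_measurableI)
    fix S :: "real set" assume "open S"
    have "g -` S \<in> sets lborel"
      using measurable_sets[OF g, of S] \<open>open S\<close> by simp
    then have 1: "g -` S \<in> sets lebesgue" by (rule sets_completionI_sets)
    have "AE x in lebesgue. x \<in> g -` S \<longleftrightarrow> x \<in> f -` S"
      using ae' by eventually_elim simp
    from completion.in_sets_AE[OF this 1] show "f -` S \<inter> space lebesgue \<in> sets lebesgue" by simp
  qed
  have g': "g \<in> borel_measurable lborel" using g by simp
  have "integral\<^sup>L lebesgue f = integral\<^sup>L lebesgue g"
    by (rule integral_cong_AE[OF f measurable_completion[OF g'] ae'])
  also have "\<dots> = integral\<^sup>L lborel g" by (rule integral_completion[OF g'])
  finally show "integral\<^sup>L lebesgue f = integral\<^sup>L lborel g" .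
qed

lemma lborel_null_cover:
  fixes P :: "'a::euclidean_space \<Rightarrow> bool"
  assumes "AE p in lborel. P p"
  obtains N where "N \<in> null_sets lborel" "N \<in> sets borel" "\<And>p. p \<notin> N \<Longrightarrow> P p"
proof -
  obtain N where N: "\<And>p. p \<in> space lborel - N \<Longrightarrow> P p" "N \<in> null_sets lborel"
    by (rule AE_E3[OF assms]) blast
  show thesis using N by (intro that[of N]) (simp_all add: null_sets_def)
qed

lemma lborel_swap_AE:
  fixes P :: "'a::euclidean_space \<times> 'b::euclidean_space \<Rightarrow> bool"
  assumes "AE p in lborel. P p"
  shows "AE z in lborel. AE r in lborel. P (r, z)"
proof -
  obtain N where N: "N \<in> null_sets lborel" "N \<in> sets borel" "\<And>p. p \<notin> N \<Longrightarrow> P p"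
    by (rule lborel_null_cover[OF assms]) blast
  have "AE p in lborel \<Otimes>\<^sub>M lborel. p \<notin> N" unfolding lborel_prod using N(1) by (rule AE_not_in)
  then have "AE r in lborel. AE z in lborel. (r, z) \<notin> N" by (rule lborel_pair.AE_pair)
  moreover have "{p \<in> space (lborel \<Otimes>\<^sub>M lborel). (fst p, snd p) \<notin> N} \<in> sets (lborel \<Otimes>\<^sub>M lborel)"
  proof -
    have eq: "{p \<in> space (lborel \<Otimes>\<^sub>M lborel). (fst p, snd p) \<notin> N} = - N" by (simp add: lborel_prod Compl_eq)
    show ?thesis unfolding eq using borel_comp[OF N(2)] by (simp only: lborel_prod sets_lborel)
  qed
  ultimately have "AE z in lborel. AE r in lborel. (r, z) \<notin> N"
    by (subst (asm) lborel_pair.AE_commute[of "\<lambda>r z. (r, z) \<notin> N"])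
  then show ?thesis
  proof eventually_elim
    case (elim z)
    then show ?case by eventually_elim (rule N(3))
  qed
qed

lemma AE_snd_lborel:
  fixes P :: "'b::euclidean_space \<Rightarrow> bool"
  assumes "AE z in lborel. P z" 
  shows "AE p in (lborel :: ('a::euclidean_space \<times> 'b) measure). P (snd p)"
proof -
  obtain N where N: "N \<in> null_sets lborel" "N \<in> sets borel" "\<And>z. z \<notin> N \<Longrightarrow> P z"
    by (rule lborel_null_cover[OF assms]) blast
  note [measurable] = N(2)
  have "AE p in lborel \<Otimes>\<^sub>M lborel. snd (p::'a \<times> 'b) \<notin> N"
  proof (rule lborel_pair.AE_pair_measure)
    show "{x \<in> space (lborel \<Otimes>\<^sub>M lborel). snd (x::'a \<times> 'b) \<notin> N} \<in> sets (lborel \<Otimes>\<^sub>M lborel)" by measurable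
    show "AE x in lborel. AE y in lborel. snd (x::'a, y) \<notin> N" using AE_not_in[OF N(1)] by simp
  qed
  then show ?thesis unfolding lborel_prod by eventually_elim (rule N(3))
qed

lemma nn_integral_lborel_pair:
  fixes f :: "'a::euclidean_space \<times> 'b::euclidean_space \<Rightarrow> ennreal"
  assumes "f \<in> borel_measurable borel"
  shows "(\<integral>\<^sup>+p. f p \<partial>lborel) = (\<integral>\<^sup>+x. \<integral>\<^sup>+y. f (x, y) \<partial>lborel \<partial>lborel)"
    and "(\<integral>\<^sup>+p. f p \<partial>lborel) = (\<integral>\<^sup>+y. \<integral>\<^sup>+x. f (x, y) \<partial>lborel \<partial>lborel)"
proof -
  have *: "f \<in> borel_measurable (lborel \<Otimes>\<^sub>M lborel)" using assms by (simp add: lborel_prod)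
  show "(\<integral>\<^sup>+p. f p \<partial>lborel) = (\<integral>\<^sup>+x. \<integral>\<^sup>+y. f (x, y) \<partial>lborel \<partial>lborel)"
    using lborel.nn_integral_fst[OF *] by (simp add: lborel_prod)
  show "(\<integral>\<^sup>+p. f p \<partial>lborel) = (\<integral>\<^sup>+y. \<integral>\<^sup>+x. f (x, y) \<partial>lborel \<partial>lborel)"
    using lborel_pair.nn_integral_snd[OF *] by (simp add: lborel_prod)
qed

lemma integrable_pairI:
  fixes f :: "'a::euclidean_space \<Rightarrow> 'b::euclidean_space \<Rightarrow> real"
  assumes [measurable]: "case_prod f \<in> borel_measurable (lborel \<Otimes>\<^sub>M lborel)"
    and fin: "(\<integral>\<^sup>+y. \<integral>\<^sup>+x. ennreal \<bar>f x y\<bar> \<partial>lborel \<partial>lborel) < \<infinity>"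
  shows "integrable (lborel \<Otimes>\<^sub>M lborel) (case_prod f)"
proof (rule integrableI_bounded)
  have "(\<integral>\<^sup>+p. ennreal (norm (case_prod f p)) \<partial>(lborel \<Otimes>\<^sub>M lborel)) = (\<integral>\<^sup>+y. \<integral>\<^sup>+x. ennreal (norm (case_prod f (x, y))) \<partial>lborel \<partial>lborel)"
    by (rule lborel_pair.nn_integral_snd[symmetric]) measurable
  then show "(\<integral>\<^sup>+p. ennreal (norm (case_prod f p)) \<partial>(lborel \<Otimes>\<^sub>M lborel)) < \<infinity>"
    using fin by simp
qed fact

section \<open>Oscillation and total variation\<close>

text \<open>The field \<open>(\<eta> osc h \<psi>, 0) / (2 h)\<close> is a test field, and its divergence is
\<open>r (\<psi> - avg h \<psi>) / (2 h)\<close> at almost every point where \<open>w\<close> does not vanish. The cutoff \<open>\<eta>\<close> is indispensable because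
\<open>osc h \<psi>\<close> need not vanish near \<open>r = 1\<close>; it is harmless because \<open>w\<close> does.\<close>

lemma TV_controls_oscillation:
  fixes v w :: "real \<times> real \<Rightarrow> real"
  assumes [measurable]: "w \<in> borel_measurable borel"
    and vw: "AE p in lborel. p \<in> Omega \<longrightarrow> v p = w p"
    and w0: "\<And>p. p \<notin> Omega \<Longrightarrow> w p = 0"
    and \<delta>: "0 < \<delta>" "AE p in lborel. 1 - \<delta> \<le> fst p \<longrightarrow> w p = 0"
    and TV: "TV v < \<infinity>" and \<psi>: "admissible \<psi>" and h: "0 < h"
  shows "(\<integral>p. w p * (fst p * (\<psi> p - avg h (\<lambda>t. \<psi> (t, snd p)) (fst p))) \<partial>lborel) \<le> 2 * h * enn2real (TV v)"
proof -
  \<comment> \<open>\<open>\<eta>\<close> falls from 1 at \<open>1 - \<delta>\<close> to 0 at \<open>1 - \<delta> / 2\<close>.\<close>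
  define \<eta> where "\<eta> s = smoothstep (- 2 / \<delta> * s + 2 / \<delta> * (1 - \<delta> / 2))" for s
  obtain \<eta>' where \<eta>': "continuous_on UNIV \<eta>'" "\<And>t. (\<eta> has_real_derivative \<eta>' t) (at t)"
    using smoothstep_affine_C1 unfolding \<eta>_def[abs_def] by blast
  have \<eta>01: "0 \<le> \<eta> s" "\<eta> s \<le> 1" for s by (simp_all add: \<eta>_def smoothstep_simps)
  have \<eta>_eq: "\<eta> s = smoothstep (2 * (1 - s) / \<delta> - 1)" for s
    unfolding \<eta>_def using \<delta>(1) by (intro arg_cong[of _ _ smoothstep]) (simp add: field_simps)
  have \<eta>1: "\<eta> s = 1" if "s \<le> 1 - \<delta>" for s
    unfolding \<eta>_eq by (rule smoothstep_simps(2)) (use that \<delta>(1) in \<open>simp add: pos_le_divide_eq\<close>)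
  have \<eta>0: "\<eta> s = 0" if "1 - \<delta> / 2 \<le> s" for s
    unfolding \<eta>_eq by (rule smoothstep_simps(1)) (use that \<delta>(1) in \<open>simp add: pos_divide_le_eq\<close>)
  have \<eta>'0: "\<eta>' s = 0" if "s < 1 - \<delta>" for s
  proof -
    have "(\<eta> has_real_derivative 0) (at s)"
      by (rule has_field_derivative_transform_within_open[of "\<lambda>_. 1" _ _ "{..<1 - \<delta>}"]) (use that in \<open>auto simp: \<eta>1\<close>)
    then show ?thesis using \<eta>'(2) DERIV_unique by blast
  qed
  obtain e where e: "0 < e" "\<And>p. \<psi> p \<noteq> 0 \<Longrightarrow> e \<le> fst p \<and> fst p \<le> 1 - e \<and> \<bar>snd p\<bar> \<le> 1 - e"
    and \<psi>T: "\<psi> \<in> tensors" and \<psi>1: "\<And>p. \<bar>\<psi> p\<bar> \<le> 1"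
    using \<psi> unfolding admissible_def by blast
  have \<psi>0: "\<psi> (t, z) = 0" if "t < e \<or> 1 - e < \<bar>z\<bar>" for t z
    using e(2)[of "(t, z)"] that by (cases "\<psi> (t, z) = 0") auto
  note slice = tensors_cont_slice[OF \<psi>T]
  define F where "F p = \<eta> (fst p) * osc h (\<lambda>t. \<psi> (t, snd p)) (fst p)" for p
  define D where "D p = fst p * (\<psi> p - avg h (\<lambda>t. \<psi> (t, snd p)) (fst p))" for p
  define Fr where "Fr p = \<eta>' (fst p) * osc h (\<lambda>t. \<psi> (t, snd p)) (fst p) + \<eta> (fst p) * D p" for p
  obtain Fz where Fz: "continuous_on UNIV Fr" "continuous_on UNIV Fz"
    "\<And>p. (F has_derivative (\<lambda>k. Fr p * fst k + Fz p * snd k)) (at p)"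
    using tensors_osc_C1[OF \<psi>T h \<eta>'] unfolding C1_on_plane_def F_def Fr_def D_def by blast
  define \<phi> where "\<phi> p = (F p / (2 * h), 0::real)" for p
  have d\<phi>: "(\<phi> has_derivative (\<lambda>k. ((Fr p * fst k + Fz p * snd k) / (2 * h), 0))) (at p)" for p
    unfolding \<phi>_def by (intro has_derivative_Pair has_derivative_const)
      (use has_derivative_mult_left[OF Fz(3), of "1 / (2 * h)"] in simp)
  note fd = frechet_derivative_at[OF d\<phi>, symmetric]
  have F_supp: "p \<in> {e..1 - \<delta> / 2} \<times> {-1 + e..1 - e}" if "F p \<noteq> 0" for p
  proof -
    have "fst p \<le> 1 - \<delta> / 2" using that \<eta>0[of "fst p"] by (force simp: F_def)
    moreover have "\<bar>snd p\<bar> \<le> 1 - e"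
    proof (rule ccontr)
      assume "\<not> \<bar>snd p\<bar> \<le> 1 - e"
      then have "osc h (\<lambda>t. \<psi> (t, snd p)) (fst p) = 0"
        by (intro osc_0_left[of _ "max 0 (fst p)"] slice h \<psi>0) auto
      then show False using that by (simp add: F_def)
    qed
    moreover have "e \<le> fst p"
    proof (rule ccontr)
      assume "\<not> e \<le> fst p"
      then have "osc h (\<lambda>t. \<psi> (t, snd p)) (fst p) = 0"
        using e(1) by (intro osc_0_left[of _ "max 0 (fst p)"] slice h \<psi>0) auto
      then show False using that by (simp add: F_def)
    qed
    ultimately show ?thesis by (cases p) (auto simp: abs_le_iff)
  qed
  have "\<phi> \<in> test_fields"
    unfolding test_fields_def mem_Collect_eq
  proof (intro conjI allI ballI)
    show "\<phi> differentiable at p" for p by (rule differentiableI[OF d\<phi>])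
    show "continuous_on UNIV (\<lambda>p. frechet_derivative \<phi> (at p) k)" for k
      unfolding fd using h
      by (intro continuous_on_Pair continuous_on_divide continuous_on_add continuous_on_mult continuous_on_const Fz) auto
    have "{p. \<phi> p \<noteq> 0} \<subseteq> {e..1 - \<delta> / 2} \<times> {-1 + e..1 - e}"
      using F_supp by (auto simp: \<phi>_def zero_prod_def)
    then have "closure {p. \<phi> p \<noteq> 0} \<subseteq> {e..1 - \<delta> / 2} \<times> {-1 + e..1 - e}"
      by (rule closure_minimal) (intro closed_Times closed_atLeastAtMost)
    also have "\<dots> \<subseteq> interior Omega" unfolding interior_Omega using e(1) \<delta>(1) by auto
    finally show "closure {p. \<phi> p \<noteq> 0} \<subseteq> interior Omega" .
    fix p assume "p \<in> Omega"
    then have p: "0 \<le> fst p" "fst p \<le> 1" by (auto simp: Omega_def)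
    have "\<bar>osc h (\<lambda>t. \<psi> (t, snd p)) (fst p)\<bar> \<le> 2 * h"
      using e(1) by (intro osc_bound slice \<psi>1 h p \<psi>0) auto
    then have "\<bar>F p\<bar> \<le> 1 * (2 * h)" unfolding F_def abs_mult
      using \<eta>01 by (intro mult_mono) auto
    then show "norm (\<phi> p) \<le> 1" using h by (simp add: \<phi>_def norm_Pair)
  qed
  then have "ennreal (LINT p:Omega|lebesgue. v p * divergence \<phi> p) \<le> TV v"
    unfolding TV_def by (rule SUP_upper)
  then have 1: "(LINT p:Omega|lebesgue. v p * divergence \<phi> p) \<le> enn2real (TV v)"
    using enn2real_mono[of "ennreal (LINT p:Omega|lebesgue. v p * divergence \<phi> p)" "TV v"] TV
    by (cases "0 \<le> (LINT p:Omega|lebesgue. v p * divergence \<phi> p)") (auto intro: order_trans[of _ 0])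
  have "continuous_on UNIV D"
    using tensors_osc_C1[OF \<psi>T h, of "\<lambda>_. 0" "\<lambda>_. 1"] unfolding C1_on_plane_def D_def[abs_def] by simp
  then have [measurable]: "D \<in> borel_measurable borel" by (rule borel_measurable_continuous_onI)
  have "(LINT p:Omega|lebesgue. v p * divergence \<phi> p) = (\<integral>p. w p * D p / (2 * h) \<partial>lborel)"
    unfolding set_lebesgue_integral_def
  proof (rule lebesgue_eq_AE_borel)
    show "AE p in lborel. indicator Omega p *\<^sub>R (v p * divergence \<phi> p) = w p * D p / (2 * h)"
      using vw \<delta>(2)
    proof eventually_elim
      case (elim p)
      show ?case
      proof (cases "p \<in> Omega \<and> fst p < 1 - \<delta>")
        case True
        then have "Fr p = D p" by (simp add: Fr_def \<eta>1 \<eta>'0)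
        with True elim show ?thesis by (simp add: divergence_def fd)
      next
        case False
        then show ?thesis using elim w0[of p] by (cases "p \<in> Omega") auto
      qed
    qed
  qed measurable
  with 1 h show ?thesis unfolding D_def[symmetric] by (simp add: field_simps)
qed

section \<open>The Abel kernel and its inverse\<close>

text \<open>The integrand may be unbounded at both ends: only the antiderivative has to be continuous there.\<close>

lemma nn_integral_FTC_open:
  fixes F f :: "real \<Rightarrow> real"
  assumes "a \<le> b" "continuous_on {a..b} F"
    and "\<And>x. a < x \<Longrightarrow> x < b \<Longrightarrow> (F has_real_derivative f x) (at x)"
    and "\<And>x. a < x \<Longrightarrow> x < b \<Longrightarrow> 0 \<le> f x"
    and [measurable]: "f \<in> borel_measurable borel"
  shows "(\<integral>\<^sup>+x. ennreal (if a < x \<and> x < b then f x else 0) \<partial>lborel) = ennreal (F b - F a)"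
proof (rule nn_integral_has_integral_lborel)
  have "(f has_integral (F b - F a)) {a..b}"
    using assms by (intro fundamental_theorem_of_calculus_interior) (auto simp: has_real_derivative_iff_has_vector_derivative)
  then have "(f has_integral (F b - F a)) {a<..<b}"
    using has_integral_open_interval[of f "F b - F a" a b] by simp
  then have "((\<lambda>x. if x \<in> {a<..<b} then f x else 0) has_integral (F b - F a)) UNIV"
    by (simp only: has_integral_restrict_UNIV)
  then show "((\<lambda>x. if a < x \<and> x < b then f x else 0) has_integral F b - F a) UNIV"
    by simp
qed (use assms(4) in auto)

text \<open>The Abel transform of \<open>u\<close> at \<open>x > 0\<close> is the integral of \<open>u(r) r (abel_ker r x)\<close> over \<open>r\<close>.\<close>

definition abel_ker :: "real \<Rightarrow> real \<Rightarrow> real" where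
  "abel_ker r x = (if 0 < x \<and> x < r then 2 / sqrt (r\<^sup>2 - x\<^sup>2) else 0)"

text \<open>The kernel of the Abel inversion formula, up to the factor \<open>1 / \<pi>\<close>; see \<open>ker_composition\<close>.\<close>

definition inv_ker :: "real \<Rightarrow> real \<Rightarrow> real" where
  "inv_ker x t = (if 0 < t \<and> t < x then x / sqrt (x\<^sup>2 - t\<^sup>2) else 0)"

lemma abel_ker_nonneg [simp]: "0 \<le> abel_ker r x" and inv_ker_nonneg [simp]: "0 \<le> inv_ker x t"
  by (auto simp: abel_ker_def inv_ker_def power_mono)

lemma ker_measurable [measurable (raw)]: 
  assumes [measurable]: "f \<in> borel_measurable M" "g \<in> borel_measurable M"
  shows "(\<lambda>x. abel_ker (f x) (g x)) \<in> borel_measurable M" "(\<lambda>x. inv_ker (f x) (g x)) \<in> borel_measurable M"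
  unfolding abel_ker_def inv_ker_def by measurable

lemma inv_ker_abel_ker: "inv_ker x t = x / 2 * abel_ker x t"
  by (simp add: inv_ker_def abel_ker_def)

lemma abel_ker_integral:
  assumes "0 < r"
  shows "(\<integral>\<^sup>+x. ennreal (abel_ker r x) \<partial>lborel) = ennreal pi"
proof -
  have "(\<integral>\<^sup>+x. ennreal (if 0 < x \<and> x < r then 2 / sqrt (r\<^sup>2 - x\<^sup>2) else 0) \<partial>lborel)
        = ennreal (2 * arcsin (r / r) - 2 * arcsin (0 / r))"
  proof (rule nn_integral_FTC_open[where F="\<lambda>x. 2 * arcsin (x / r)"])
    show "continuous_on {0..r} (\<lambda>x. 2 * arcsin (x / r))"
      using assms by (intro continuous_intros) (auto simp: divide_simps)
    fix x assume x: "0 < x" "x < r"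
    have "sqrt (1 - (x / r)\<^sup>2) = sqrt (r\<^sup>2 - x\<^sup>2) / r"
    proof -
      have "1 - (x / r)\<^sup>2 = (r\<^sup>2 - x\<^sup>2) / r\<^sup>2" using assms by (simp add: field_simps power2_eq_square)
      then show ?thesis using assms by (simp add: real_sqrt_divide)
    qed
    then have eq: "2 * (inverse (sqrt (1 - (x / r)\<^sup>2)) * (1 / r)) = 2 / sqrt (r\<^sup>2 - x\<^sup>2)"
      using assms by (simp add: field_simps)
    have "((\<lambda>x. arcsin (x / r)) has_real_derivative inverse (sqrt (1 - (x / r)\<^sup>2)) * (1 / r)) (at x)"
    proof (rule DERIV_chain2[of arcsin])
      have "-1 < x / r" by (rule less_trans[of _ 0]) (use x assms in auto)
      then show "(arcsin has_real_derivative inverse (sqrt (1 - (x / r)\<^sup>2))) (at (x / r))"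
        using x assms by (intro DERIV_arcsin) auto
      show "((\<lambda>x. x / r) has_real_derivative 1 / r) (at x)" by (rule DERIV_cdivide) simp
    qed
    from DERIV_cmult[OF this, of 2] show "((\<lambda>x. 2 * arcsin (x / r)) has_real_derivative 2 / sqrt (r\<^sup>2 - x\<^sup>2)) (at x)"
      unfolding eq .
    show "0 \<le> 2 / sqrt (r\<^sup>2 - x\<^sup>2)" using x by (auto intro!: power_mono)
  qed (use assms in auto)
  then show ?thesis using assms by (simp add: abel_ker_def)
qed

lemma abel_ker_mass:
  assumes "r \<notin> {0<..<1} \<Longrightarrow> a = 0"
  shows "(\<integral>\<^sup>+x. ennreal \<bar>a * r * abel_ker r x\<bar> \<partial>lborel) \<le> ennreal pi * ennreal \<bar>a\<bar>"
proof (cases "r \<in> {0<..<1}")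
  case True
  then have "(\<integral>\<^sup>+x. ennreal \<bar>a * r * abel_ker r x\<bar> \<partial>lborel) = ennreal (\<bar>a\<bar> * r) * ennreal pi"
    by (simp add: abs_mult ennreal_mult nn_integral_cmult abel_ker_integral)
  also have "\<dots> \<le> ennreal \<bar>a\<bar> * ennreal pi"
    using True by (intro mult_right_mono ennreal_leI) (auto intro: mult_left_le)
  finally show ?thesis by (simp add: mult.commute)
qed (simp add: assms)

text \<open>The identity behind Abel inversion: composing the two kernels produces plain integration from
\<open>0\<close> to \<open>r\<close>. The integrand in \<open>x\<close> has the antiderivative
\<open>arcsin ((2 x\<^sup>2 - t\<^sup>2 - r\<^sup>2) / (r\<^sup>2 - t\<^sup>2))\<close>, which runs from \<open>-\<pi>/2\<close> at \<open>x = t\<close> to \<open>\<pi>/2\<close> at \<open>x = r\<close>.\<close>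

lemma ker_composition:
  "(\<integral>\<^sup>+x. ennreal (abel_ker r x * inv_ker x t) \<partial>lborel) = ennreal (if 0 < t \<and> t < r then pi else 0)"
proof (cases "0 < t \<and> t < r")
  case True
  define d where "d = r\<^sup>2 - t\<^sup>2"
  define g where "g x = (2 * x\<^sup>2 - t\<^sup>2 - r\<^sup>2) / d" for x
  have d: "0 < d" using True by (auto simp: d_def intro!: power_strict_mono)
  let ?f = "\<lambda>x. 2 / sqrt (r\<^sup>2 - x\<^sup>2) * (x / sqrt (x\<^sup>2 - t\<^sup>2))"
  have 1: "g t = -1" "g r = 1" using d by (auto simp: g_def d_def field_simps)
  have "(\<integral>\<^sup>+x. ennreal (if t < x \<and> x < r then ?f x else 0) \<partial>lborel) = ennreal (arcsin (g r) - arcsin (g t))"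
  proof (rule nn_integral_FTC_open)
    have "-1 \<le> g x" "g x \<le> 1" if "t \<le> x" "x \<le> r" for x
    proof -
      have "t\<^sup>2 \<le> x\<^sup>2" "x\<^sup>2 \<le> r\<^sup>2" using that True by (auto intro!: power_mono)
      then show "-1 \<le> g x" "g x \<le> 1" using d by (auto simp: g_def d_def field_simps)
    qed
    then show "continuous_on {t..r} (\<lambda>x. arcsin (g x))"
      using d by (intro continuous_on_arcsin) (auto simp: g_def intro!: continuous_intros)
    fix x assume x: "t < x" "x < r"
    \<comment> \<open>With \<open>g\<close> the argument of the arcsine, \<open>1 - (g x)\<^sup>2\<close> factors into the two radicands.\<close>
    have sq: "t\<^sup>2 < x\<^sup>2" "x\<^sup>2 < r\<^sup>2" using x True by (auto intro!: power_strict_mono)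
    then have g: "-1 < g x" "g x < 1" using d by (auto simp: g_def d_def field_simps)
    have "1 - (g x)\<^sup>2 = 4 * ((r\<^sup>2 - x\<^sup>2) * (x\<^sup>2 - t\<^sup>2)) / d\<^sup>2"
    proof -
      have "d\<^sup>2 - (2 * x\<^sup>2 - t\<^sup>2 - r\<^sup>2)\<^sup>2 = 4 * ((r\<^sup>2 - x\<^sup>2) * (x\<^sup>2 - t\<^sup>2))"
        unfolding d_def by algebra
      then show ?thesis using d by (simp add: g_def power_divide diff_divide_distrib[symmetric] divide_simps)
    qed
    then have s: "sqrt (1 - (g x)\<^sup>2) = 2 * (sqrt (r\<^sup>2 - x\<^sup>2) * sqrt (x\<^sup>2 - t\<^sup>2)) / d"
      using d by (simp add: real_sqrt_divide real_sqrt_mult)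
    have eq: "inverse (sqrt (1 - (g x)\<^sup>2)) * (4 * x / d) = ?f x"
      unfolding s using d sq by (simp add: field_simps)
    have "((\<lambda>x. arcsin (g x)) has_real_derivative inverse (sqrt (1 - (g x)\<^sup>2)) * (4 * x / d)) (at x)"
    proof (rule DERIV_chain2[of arcsin])
      show "(arcsin has_real_derivative inverse (sqrt (1 - (g x)\<^sup>2))) (at (g x))"
        using g by (intro DERIV_arcsin)
      show "(g has_real_derivative 4 * x / d) (at x)" 
        unfolding g_def[abs_def] by (rule DERIV_cdivide) (auto intro!: derivative_eq_intros)
    qed
    then show "((\<lambda>x. arcsin (g x)) has_real_derivative ?f x) (at x)" unfolding eq .
    show "0 \<le> ?f x" using x True sq by auto
  qed (use True in auto)
  moreover have "abel_ker r x * inv_ker x t = (if t < x \<and> x < r then ?f x else 0)" for x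
    using True by (auto simp: abel_ker_def inv_ker_def)
  ultimately show ?thesis using True by (simp add: 1)
next
  case False
  then have "abel_ker r x * inv_ker x t = 0" for x by (auto simp: abel_ker_def inv_ker_def)
  then have "(\<lambda>x. ennreal (abel_ker r x * inv_ker x t)) = (\<lambda>x. 0)" by (simp only: ennreal_0)
  with False show ?thesis by auto
qed

lemma inv_sqrt_tail:
  assumes "0 < h"
  shows "(\<integral>\<^sup>+t. ennreal (if x - h < t \<and> t < x then 1 / sqrt (x - t) else 0) \<partial>lborel) = ennreal (2 * sqrt h)"
proof -
  have "(\<integral>\<^sup>+t. ennreal (if x - h < t \<and> t < x then 1 / sqrt (x - t) else 0) \<partial>lborel) 
     = ennreal (- 2 * sqrt (x - x) - - 2 * sqrt (x - (x - h)))"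
  proof (rule nn_integral_FTC_open[where F="\<lambda>t. - 2 * sqrt (x - t)"])
    fix t assume "x - h < t" "t < x"
    then show "((\<lambda>t. - 2 * sqrt (x - t)) has_real_derivative 1 / sqrt (x - t)) (at t)"
      by (auto intro!: derivative_eq_intros simp: field_simps)
    show "0 \<le> 1 / sqrt (x - t)" using \<open>t < x\<close> by simp
  qed (use assms in \<open>auto intro!: continuous_intros\<close>)
  then show ?thesis by simp
qed

lemma inv_ker_bound: 
  assumes "0 < x" "x \<le> 1" "t < x"
  shows "inv_ker x t \<le> 1 / sqrt (x - t)"
proof (cases "0 < t")
  case True
  have "x\<^sup>2 * (x - t) \<le> x\<^sup>2 - t\<^sup>2"
  proof -
    have "x\<^sup>2 * (x - t) \<le> (x + t) * (x - t)"
      using assms True by (intro mult_right_mono) (auto simp: power2_eq_square mult_left_le add_increasing2)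
    then show ?thesis by (simp add: power2_eq_square algebra_simps)
  qed
  then have "x * sqrt (x - t) \<le> sqrt (x\<^sup>2 - t\<^sup>2)"
    using assms by (metis real_sqrt_le_mono real_sqrt_mult real_sqrt_unique abs_of_pos real_sqrt_abs)
  moreover have "0 < sqrt (x\<^sup>2 - t\<^sup>2)" "0 < sqrt (x - t)" using assms True by (auto intro!: power_strict_mono)
  ultimately show ?thesis using True assms by (simp add: inv_ker_def divide_simps)
qed (use assms in \<open>auto simp: inv_ker_def\<close>)

lemma inv_ker_mono: 
  assumes "0 < t" "t \<le> t'" "t' < x" 
  shows "inv_ker x t \<le> inv_ker x t'"
proof -
  have "t'\<^sup>2 < x\<^sup>2" "t\<^sup>2 \<le> t'\<^sup>2" using assms by (auto intro!: power_strict_mono power_mono)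
  moreover from this have "t\<^sup>2 < x\<^sup>2" by linarith
  ultimately show ?thesis using assms by (auto simp: inv_ker_def intro!: divide_left_mono mult_pos_pos)
qed

section \<open>Averages and the Abel transform\<close>

lemma has_bochner_inv_ker:
  assumes "0 < x"
  shows "has_bochner_integral lborel (inv_ker x) (pi / 2 * x)"
proof (rule has_bochner_integral_nn_integral)
  have "(\<integral>\<^sup>+t. ennreal (inv_ker x t) \<partial>lborel) = (\<integral>\<^sup>+t. ennreal (x / 2) * ennreal (abel_ker x t) \<partial>lborel)"
    using assms by (intro nn_integral_cong) (simp add: inv_ker_abel_ker ennreal_mult[symmetric])
  also have "\<dots> = ennreal (x / 2) * ennreal pi"
    using abel_ker_integral[OF assms] by (simp add: nn_integral_cmult)
  also have "\<dots> = ennreal (pi / 2 * x)" using assms by (simp add: ennreal_mult[symmetric] mult_ac)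
  finally show "(\<integral>\<^sup>+t. ennreal (inv_ker x t) \<partial>lborel) = ennreal (pi / 2 * x)" .
qed (use assms in \<open>auto\<close>)

text \<open>Up to the factor \<open>1 / (\<pi> h)\<close>, the weight whose transposed Abel transform is \<open>avg h c\<close>.\<close>

definition dual_weight :: "real \<Rightarrow> (real \<Rightarrow> real) \<Rightarrow> real \<Rightarrow> real" where
  "dual_weight h c x = (\<integral>t. (c t - c (t - h)) * inv_ker x t \<partial>lborel)"

text \<open>Translating by \<open>h\<close> moves the difference from \<open>c\<close> to the kernel \<open>K\<close>. Where \<open>t + h < x\<close>, monotonicity
gives \<open>|K t - K (t + h)| = K (t + h) - K t\<close>, and where \<open>t + h \<ge> x\<close> the second kernel value is zero.
In both cases the modulus is at most \<open>K (t + h) - K t\<close> plus twice the part of \<open>K\<close> on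
\<open>[x - h, x)\<close>; the first two terms cancel after integration and the last one contributes at most
\<open>2 * (2 \<surd>h)\<close>.\<close>

lemma dual_weight_bound:
  assumes [measurable]: "c \<in> borel_measurable borel" and c: "\<And>t. \<bar>c t\<bar> \<le> 1" "\<And>t. t \<le> 0 \<Longrightarrow> c t = 0"
    and h: "0 < h" and x: "0 < x" "x \<le> 1"
  shows "\<bar>dual_weight h c x\<bar> \<le> 4 * sqrt h"
proof -
  let ?K = "inv_ker x"
  note hK = has_bochner_inv_ker[OF x(1)]
  have K: "integrable lborel ?K" using hK by (simp add: has_bochner_integral_iff)
  have Kh: "integrable lborel (\<lambda>t. ?K (t + h))" "(\<integral>t. ?K (t + h) \<partial>lborel) = (\<integral>t. ?K t \<partial>lborel)"
    using lborel_integrable_real_affine[OF K, of 1 h] lborel_integral_real_affine[of 1 ?K h] by (simp_all add: add.commute)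
  have cK: "integrable lborel (\<lambda>t. d t * k t)" if "integrable lborel k" "\<And>t. \<bar>d t\<bar> \<le> 1" 
    and [measurable]: "d \<in> borel_measurable borel" for d k :: "real \<Rightarrow> real"
    by (rule Bochner_Integration.integrable_bound[OF that(1)]) 
       (use that in \<open>auto simp: abs_mult intro!: mult_left_le_one_le\<close>)
  have shift: "(\<integral>t. c (t - h) * ?K t \<partial>lborel) = (\<integral>t. c t * ?K (t + h) \<partial>lborel)"
    using lborel_integral_real_affine[of 1 "\<lambda>t. c (t - h) * ?K t" h] by (simp add: add.commute)
  have "dual_weight h c x = (\<integral>t. c t * ?K t \<partial>lborel) - (\<integral>t. c (t - h) * ?K t \<partial>lborel)"
    unfolding dual_weight_def left_diff_distrib
    by (rule Bochner_Integration.integral_diff) (intro cK K c; measurable)+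
  also have "\<dots> = (\<integral>t. c t * ?K t - c t * ?K (t + h) \<partial>lborel)"
    unfolding shift by (rule Bochner_Integration.integral_diff[symmetric]) (intro cK K Kh c; measurable)+
  finally have eq: "dual_weight h c x = (\<integral>t. c t * (?K t - ?K (t + h)) \<partial>lborel)"
    by (simp add: right_diff_distrib)
  let ?T = "\<lambda>t. if x - h \<le> t then ?K t else 0"
  have T: "integrable lborel ?T"
    by (rule Bochner_Integration.integrable_bound[OF K]) auto
  have "norm (dual_weight h c x) \<le> (\<integral>t. ?K (t + h) - ?K t + 2 * ?T t \<partial>lborel)"
    unfolding eq
  proof (rule Bochner_Integration.integral_norm_bound_integral)
    show "integrable lborel (\<lambda>t. c t * (?K t - ?K (t + h)))"
      using K Kh c by (intro cK) auto
    show "integrable lborel (\<lambda>t. ?K (t + h) - ?K t + 2 * ?T t)"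
      using K Kh T by auto
    fix t
    have R: "\<bar>?K t - ?K (t + h)\<bar> \<le> ?K (t + h) - ?K t + 2 * ?T t" if "0 < t"
    proof (cases "t + h < x")
      case True
      then show ?thesis using inv_ker_mono[of t "t + h" x] that h by simp
    next
      case False
      then have "?K (t + h) = 0" by (simp add: inv_ker_def)
      then show ?thesis using False by simp
    qed
    show "norm (c t * (?K t - ?K (t + h))) \<le> ?K (t + h) - ?K t + 2 * ?T t"
    proof (cases "0 < t")
      case True
      have "\<bar>c t\<bar> * \<bar>?K t - ?K (t + h)\<bar> \<le> \<bar>?K t - ?K (t + h)\<bar>"
        using c(1)[of t] by (simp add: mult_left_le_one_le)
      then show ?thesis using R[OF True] by (simp add: abs_mult)
    next
      case False
      then have "?K t = 0" "c t = 0" using c(2) by (auto simp: inv_ker_def)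
      then show ?thesis by simp
    qed
  qed
  also have "\<dots> = 2 * (\<integral>t. ?T t \<partial>lborel)"
    using K Kh T by simp
  also have "(\<integral>t. ?T t \<partial>lborel) \<le> 2 * sqrt h"
  proof -
    have "ennreal (\<integral>t. ?T t \<partial>lborel) = (\<integral>\<^sup>+t. ennreal (?T t) \<partial>lborel)"
      by (rule nn_integral_eq_integral[symmetric]) (use T in auto)
    also have "\<dots> \<le> (\<integral>\<^sup>+t. ennreal (if x - h < t \<and> t < x then 1 / sqrt (x - t) else 0) \<partial>lborel)"
    proof (rule nn_integral_mono_AE)
      show "AE t in lborel. ennreal (?T t) \<le> ennreal (if x - h < t \<and> t < x then 1 / sqrt (x - t) else 0)"
        using AE_lborel_singleton[of "x - h"]
      proof eventually_elim
        case (elim t)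
        show ?case using elim inv_ker_bound[OF x, of t]
          by (cases "t < x") (auto intro!: ennreal_leI simp: inv_ker_def)
      qed
    qed
    also have "\<dots> = ennreal (2 * sqrt h)" by (rule inv_sqrt_tail[OF h])
    finally show ?thesis using h by simp
  qed
  finally show ?thesis by simp
qed

text \<open>By Fubini and \<open>ker_composition\<close>, the left side is \<open>\<pi>\<close> times the integral of \<open>c t - c (t - h)\<close> over
\<open>[0, r]\<close>, which telescopes because \<open>c\<close> vanishes for \<open>t \<le> 0\<close>.\<close>

lemma abel_dual_weight:
  assumes cont: "continuous_on UNIV c" and c: "\<And>t. \<bar>c t\<bar> \<le> 1" "\<And>t. t \<le> 0 \<Longrightarrow> c t = 0"
    and h: "0 < h" and r: "0 < r"
  shows "(\<integral>x. abel_ker r x * dual_weight h c x \<partial>lborel) = pi * h * avg h c r"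
proof -
  have cm [measurable]: "c \<in> borel_measurable borel" using cont by (rule borel_measurable_continuous_onI)
  define d where "d t = c t - c (t - h)" for t
  have [measurable]: "d \<in> borel_measurable borel" unfolding d_def by measurable
  have d2: "\<bar>d t\<bar> \<le> 2" for t using c(1)[of t] c(1)[of "t - h"] unfolding d_def by linarith
  have nn: "(\<integral>\<^sup>+x. ennreal \<bar>d t * (abel_ker r x * inv_ker x t)\<bar> \<partial>lborel) = ennreal (\<bar>d t\<bar> * (if 0 < t \<and> t < r then pi else 0))" for t
    by (simp add: abs_mult ennreal_mult nn_integral_cmult ker_composition[symmetric])
  have "integrable (lborel \<Otimes>\<^sub>M lborel) (\<lambda>(x, t). d t * (abel_ker r x * inv_ker x t))"
  proof (rule integrable_pairI)
    have "(\<integral>\<^sup>+t. \<integral>\<^sup>+x. ennreal \<bar>d t * (abel_ker r x * inv_ker x t)\<bar> \<partial>lborel \<partial>lborel) 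
        \<le> (\<integral>\<^sup>+t. ennreal (2 * pi) * indicator {0..r} t \<partial>lborel)"
      unfolding nn using d2 by (intro nn_integral_mono) (auto intro!: ennreal_leI split: split_indicator)
    also have "\<dots> < \<infinity>" using r by (simp add: nn_integral_cmult_indicator ennreal_mult_less_top)
    finally show "(\<integral>\<^sup>+t. \<integral>\<^sup>+x. ennreal \<bar>d t * (abel_ker r x * inv_ker x t)\<bar> \<partial>lborel \<partial>lborel) < \<infinity>" .
  qed measurable
  from lborel_pair.Fubini_integral[OF this]
  have "(\<integral>x. \<integral>t. d t * (abel_ker r x * inv_ker x t) \<partial>lborel \<partial>lborel) 
      = (\<integral>t. \<integral>x. d t * (abel_ker r x * inv_ker x t) \<partial>lborel \<partial>lborel)" by simp
  also have "\<dots> = (\<integral>t. pi * (d t * indicator {0..r} t) \<partial>lborel)"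
  proof (rule integral_cong_AE)
    have "(\<integral>x. abel_ker r x * inv_ker x t \<partial>lborel) = (if 0 < t \<and> t < r then pi else 0)" for t
      by (subst integral_eq_nn_integral) (simp_all add: ker_composition)
    then have "(\<integral>x. d t * (abel_ker r x * inv_ker x t) \<partial>lborel) = d t * (if 0 < t \<and> t < r then pi else 0)" for t
      by (simp only: integral_mult_right_zero)
    note dJK = this
    show "AE t in lborel. (\<integral>x. d t * (abel_ker r x * inv_ker x t) \<partial>lborel) = pi * (d t * indicator {0..r} t)"
      using AE_lborel_singleton[of 0] AE_lborel_singleton[of r]
    proof eventually_elim
      case (elim t)
      then show ?case unfolding dJK by (auto split: split_indicator)
    qed
  qed measurable
  also have "\<dots> = pi * (\<integral>t. d t * indicator {0..r} t \<partial>lborel)" by simp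
  also have "(\<integral>t. d t * indicator {0..r} t \<partial>lborel) = (prim c r - prim c (r - h)) - (prim c 0 - prim c (0 - h))"
  proof (rule integral_FTC_Icc_real)
    show "((\<lambda>t. prim c t - prim c (t - h)) has_real_derivative d t) (at t)" for t
      using DERIV_shift[of "prim c" "c (t - h)" t "- h"] prim_deriv(1)[OF cont, of "t - h"]
      unfolding d_def by (intro DERIV_diff prim_deriv(1)[OF cont]) simp
    have "continuous_on UNIV d" unfolding d_def[abs_def]
      by (intro continuous_on_diff cont continuous_on_compose2[OF cont, of UNIV "\<lambda>s. s - h"]) (auto intro: continuous_on_diff)
    then show "isCont d t" for t by (simp add: continuous_on_eq_continuous_at)
  qed (use r in simp)
  also have "\<dots> = h * avg h c r"
  proof -
    have "prim c s = 0" if "s \<le> 0" for s by (rule prim_0_left[OF cont c(2), of 0]) (use that in auto)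
    then show ?thesis using h by (simp add: avg_def)
  qed
  finally show ?thesis
    by (simp add: dual_weight_def d_def mult.left_commute[of _ "abel_ker r _"])
qed

text \<open>Fubini moves the Abel transform from the averaged test function onto \<open>W\<close>. Since \<open>W\<close> lives on
\<open>(0, 1)\<close>, only weights at \<open>x \<in> (0, 1)\<close> matter, and there the bound on \<open>dual_weight\<close> applies.\<close>

lemma averaged_pairing_bound:
  assumes W: "integrable lborel W" "\<And>r. r \<notin> {0<..<1} \<Longrightarrow> W r = 0"
    and cont: "continuous_on UNIV c" and c: "\<And>t. \<bar>c t\<bar> \<le> 1" "\<And>t. t \<le> 0 \<Longrightarrow> c t = 0"
    and h: "0 < h"
  shows "\<bar>\<integral>r. W r * (r * avg h c r) \<partial>lborel\<bar> \<le> 4 / (pi * sqrt h) * (\<integral>x. \<bar>\<integral>r. W r * r * abel_ker r x \<partial>lborel\<bar> \<partial>lborel)"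
proof -
  have [measurable]: "W \<in> borel_measurable borel" using W(1) by auto
  have [measurable]: "c \<in> borel_measurable borel" using cont by (rule borel_measurable_continuous_onI)
  \<comment> \<open>Truncation makes the bound on \<open>dual_weight\<close> global without changing any integral below.\<close>
  define D where "D x = (if 0 < x \<and> x \<le> 1 then dual_weight h c x else 0)" for x
  have [measurable]: "D \<in> borel_measurable borel" unfolding D_def dual_weight_def by measurable
  have D: "\<bar>D x\<bar> \<le> 4 * sqrt h" for x
    using dual_weight_bound[of c h x] c h by (auto simp: D_def)
  have DJ: "abel_ker r x * dual_weight h c x = abel_ker r x * D x" if "r < 1" for r x
    using that by (auto simp: D_def abel_ker_def)
  define G where "G x = (\<integral>r. W r * r * abel_ker r x \<partial>lborel)" for x
  have Wfin: "(\<integral>\<^sup>+r. ennreal \<bar>W r\<bar> \<partial>lborel) < \<infinity>" using W(1) by (simp add: integrable_iff_bounded)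
  have WJ: "integrable (lborel \<Otimes>\<^sub>M lborel) (\<lambda>(x, r). W r * r * abel_ker r x)"
  proof (rule integrable_pairI)
    have "(\<integral>\<^sup>+r. \<integral>\<^sup>+x. ennreal \<bar>W r * r * abel_ker r x\<bar> \<partial>lborel \<partial>lborel) \<le> (\<integral>\<^sup>+r. ennreal pi * ennreal \<bar>W r\<bar> \<partial>lborel)"
      using abel_ker_mass[OF W(2)] by (intro nn_integral_mono)
    also have "\<dots> < \<infinity>" using Wfin by (simp add: nn_integral_cmult ennreal_mult_less_top)
    finally show "(\<integral>\<^sup>+r. \<integral>\<^sup>+x. ennreal \<bar>W r * r * abel_ker r x\<bar> \<partial>lborel \<partial>lborel) < \<infinity>" .
  qed measurable
  have G: "integrable lborel G"
    using lborel_pair.integrable_fst'[OF WJ] by (simp add: G_def[abs_def])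
  have WJD: "integrable (lborel \<Otimes>\<^sub>M lborel) (\<lambda>(x, r). D x * (W r * r * abel_ker r x))"
  proof (rule Bochner_Integration.integrable_bound[OF integrable_mult_left[OF WJ, of "4 * sqrt h"]])
    show "AE p in lborel \<Otimes>\<^sub>M lborel. norm (case p of (x, r) \<Rightarrow> D x * (W r * r * abel_ker r x)) 
        \<le> norm ((case p of (x, r) \<Rightarrow> W r * r * abel_ker r x) * (4 * sqrt h))"
    proof (intro always_eventually allI)
      fix p :: "real \<times> real"
      have "\<bar>D (fst p)\<bar> * \<bar>W (snd p) * snd p * abel_ker (snd p) (fst p)\<bar> \<le> (4 * sqrt h) * \<bar>W (snd p) * snd p * abel_ker (snd p) (fst p)\<bar>"
        by (intro mult_right_mono D) auto
      then show "norm (case p of (x, r) \<Rightarrow> D x * (W r * r * abel_ker r x)) 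
        \<le> norm ((case p of (x, r) \<Rightarrow> W r * r * abel_ker r x) * (4 * sqrt h))"
        using h by (cases p) (simp add: abs_mult mult_ac)
    qed
  qed measurable
  have "(\<integral>r. W r * (r * avg h c r) \<partial>lborel) = (\<integral>r. 1 / (pi * h) * (\<integral>x. D x * (W r * r * abel_ker r x) \<partial>lborel) \<partial>lborel)"
  proof (rule Bochner_Integration.integral_cong)
    fix r
    show "W r * (r * avg h c r) = 1 / (pi * h) * (\<integral>x. D x * (W r * r * abel_ker r x) \<partial>lborel)"
    proof (cases "r \<in> {0<..<1}")
      case True
      then have "(\<integral>x. abel_ker r x * D x \<partial>lborel) = pi * h * avg h c r"
        using abel_dual_weight[of c h r] cont c h by (simp add: DJ)
      moreover have "(\<integral>x. D x * (W r * r * abel_ker r x) \<partial>lborel) = W r * r * (\<integral>x. abel_ker r x * D x \<partial>lborel)"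
        by (subst integral_mult_right_zero[symmetric]) (simp add: mult_ac)
      ultimately show ?thesis using h by simp
    qed (simp add: W(2))
  qed simp
  also have "\<dots> = 1 / (pi * h) * (\<integral>r. \<integral>x. D x * (W r * r * abel_ker r x) \<partial>lborel \<partial>lborel)" by simp
  also have "(\<integral>r. \<integral>x. D x * (W r * r * abel_ker r x) \<partial>lborel \<partial>lborel) = (\<integral>x. \<integral>r. D x * (W r * r * abel_ker r x) \<partial>lborel \<partial>lborel)"
    using lborel_pair.Fubini_integral[OF WJD] by simp
  also have "\<dots> = (\<integral>x. D x * G x \<partial>lborel)" by (simp add: G_def[abs_def])
  finally have "\<bar>\<integral>r. W r * (r * avg h c r) \<partial>lborel\<bar> = 1 / (pi * h) * \<bar>\<integral>x. D x * G x \<partial>lborel\<bar>"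
    using h by (simp add: abs_mult)
  also have "\<bar>\<integral>x. D x * G x \<partial>lborel\<bar> \<le> (\<integral>x. 4 * sqrt h * \<bar>G x\<bar> \<partial>lborel)"
    unfolding real_norm_def[symmetric]
  proof (rule Bochner_Integration.integral_norm_bound_integral)
    have *: "norm (D x * G x) \<le> 4 * sqrt h * norm (G x)" for x
      using D[of x] by (simp add: abs_mult mult_right_mono)
    then show "norm (D x * G x) \<le> 4 * sqrt h * norm (G x)" for x .
    show i: "integrable lborel (\<lambda>x. 4 * sqrt h * norm (G x))" using G by auto
    show "integrable lborel (\<lambda>x. D x * G x)"
      by (rule Bochner_Integration.integrable_bound[OF i]) (use G * h in \<open>auto simp: abs_mult\<close>)
  qed
  also have "1 / (pi * h) * (\<integral>x. 4 * sqrt h * \<bar>G x\<bar> \<partial>lborel) = 4 / (pi * sqrt h) * (\<integral>x. \<bar>G x\<bar> \<partial>lborel)"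
    using h by (simp add: field_simps)
  finally show ?thesis using h by (simp add: G_def divide_right_mono)
qed

definition abel_slice :: "(real \<times> real \<Rightarrow> real) \<Rightarrow> real \<Rightarrow> real \<Rightarrow> real" where
  "abel_slice w x z = (\<integral>r. w (r, z) * r * abel_ker r x \<partial>lborel)"

lemma abel_transform_eq_slice:
  assumes [measurable]: "w \<in> borel_measurable borel" and ae: "AE p in lborel. v p = w p"
  shows "AE p in lborel. 0 < fst p \<longrightarrow> abel_transform v p = abel_slice w (fst p) (snd p)"
proof -
  have "AE z in lborel. \<forall>x>0. abel_transform v (x, z) = abel_slice w x z"
    using lborel_swap_AE[OF ae]
  proof eventually_elim
    case (elim z)
    show ?case
    proof (intro allI impI)
      fix x :: real assume x: "0 < x"
      have "(LINT r:{x<..}|lebesgue. v (r, z) * r / sqrt (r\<^sup>2 - x\<^sup>2)) = (\<integral>r. 1 / 2 * (w (r, z) * r * abel_ker r x) \<partial>lborel)"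
        unfolding set_lebesgue_integral_def
      proof (rule lebesgue_eq_AE_borel(2))
        show "AE r in lborel. indicator {x<..} r *\<^sub>R (v (r, z) * r / sqrt (r\<^sup>2 - x\<^sup>2)) = 1 / 2 * (w (r, z) * r * abel_ker r x)"
          using elim by eventually_elim (use x in \<open>auto simp: abel_ker_def split: split_indicator\<close>)
      qed measurable
      then show "abel_transform v (x, z) = abel_slice w x z"
        by (simp add: abel_transform_def abel_slice_def)
    qed
  qed
  from AE_snd_lborel[OF this, where 'a=real] show ?thesis by eventually_elim (metis prod.collapse)
qed

lemma abs_avg_le_1:
  assumes "continuous_on UNIV c" "\<And>t. \<bar>c t\<bar> \<le> 1" "0 < h"
  shows "\<bar>avg h c s\<bar> \<le> 1"
proof -
  obtain z where "avg h c s = c z" using avg_eq_value[OF assms(1,3)] by metis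
  with assms(2) show ?thesis by simp
qed

text \<open>For fixed \<open>r\<close> the kernel has mass \<open>\<pi>\<close> in \<open>x\<close>, so that the Abel transform of an integrable function
on the rectangle is integrable.\<close>

lemma abel_slice_L1:
  assumes w [measurable]: "w \<in> borel_measurable borel" and iw: "integrable lborel w"
    and w0: "\<And>p. p \<notin> interior Omega \<Longrightarrow> w p = 0"
  shows "integrable (lborel \<Otimes>\<^sub>M lborel) (\<lambda>(x, z). abel_slice w x z)"
proof (rule integrable_pairI)
  have wp [measurable]: "(\<lambda>x. w (f x, g x)) \<in> borel_measurable M" if [measurable]: "f \<in> borel_measurable M" "g \<in> borel_measurable M" for f g M
    using measurable_compose[OF borel_measurable_Pair[OF that] w] .
  show "(\<lambda>(x, z). abel_slice w x z) \<in> borel_measurable (lborel \<Otimes>\<^sub>M lborel)"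
    unfolding abel_slice_def by measurable
  have le: "(\<integral>\<^sup>+x. ennreal \<bar>w (r, z) * r * abel_ker r x\<bar> \<partial>lborel) \<le> ennreal pi * ennreal \<bar>w (r, z)\<bar>" for r z
    by (rule abel_ker_mass, rule w0) (auto simp: interior_Omega)
  have "(\<integral>\<^sup>+z. \<integral>\<^sup>+x. ennreal \<bar>abel_slice w x z\<bar> \<partial>lborel \<partial>lborel)
      \<le> (\<integral>\<^sup>+z. \<integral>\<^sup>+x. \<integral>\<^sup>+r. ennreal \<bar>w (r, z) * r * abel_ker r x\<bar> \<partial>lborel \<partial>lborel \<partial>lborel)"
    unfolding abel_slice_def
  proof (intro nn_integral_mono)
    fix z x
    show "ennreal \<bar>\<integral>r. w (r, z) * r * abel_ker r x \<partial>lborel\<bar> \<le> (\<integral>\<^sup>+r. ennreal \<bar>w (r, z) * r * abel_ker r x\<bar> \<partial>lborel)"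
      by (cases "integrable lborel (\<lambda>r. w (r, z) * r * abel_ker r x)")
         (auto dest: integral_norm_bound_ennreal simp: not_integrable_integral_eq)
  qed
  also have "\<dots> = (\<integral>\<^sup>+z. \<integral>\<^sup>+r. \<integral>\<^sup>+x. ennreal \<bar>w (r, z) * r * abel_ker r x\<bar> \<partial>lborel \<partial>lborel \<partial>lborel)"
    by (intro nn_integral_cong lborel_pair.Fubini') measurable
  also have "\<dots> \<le> (\<integral>\<^sup>+z. \<integral>\<^sup>+r. ennreal pi * ennreal \<bar>w (r, z)\<bar> \<partial>lborel \<partial>lborel)"
    using le by (intro nn_integral_mono)
  also have "\<dots> = ennreal pi * (\<integral>\<^sup>+p. ennreal \<bar>w p\<bar> \<partial>lborel)"
    by (subst nn_integral_lborel_pair(2)) (simp_all add: nn_integral_cmult)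
  also have "\<dots> < \<infinity>" using iw by (simp add: integrable_iff_bounded ennreal_mult_less_top)
  finally show "(\<integral>\<^sup>+z. \<integral>\<^sup>+x. ennreal \<bar>abel_slice w x z\<bar> \<partial>lborel \<partial>lborel) < \<infinity>" .
qed

lemma averaged_pairing_bound_plane:
  assumes w [measurable]: "w \<in> borel_measurable borel" and iw: "integrable lborel w"
    and w0: "\<And>p. p \<notin> interior Omega \<Longrightarrow> w p = 0" and \<psi>: "admissible \<psi>" and h: "0 < h"
    and m: "integrable lborel (\<lambda>p. w p * (fst p * avg h (\<lambda>t. \<psi> (t, snd p)) (fst p)))"
  shows "(\<integral>p. w p * (fst p * avg h (\<lambda>t. \<psi> (t, snd p)) (fst p)) \<partial>lborel)
     \<le> 4 / (pi * sqrt h) * (\<integral>p. \<bar>abel_slice w (fst p) (snd p)\<bar> \<partial>lborel)"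
proof -
  let ?m = "\<lambda>r z. w (r, z) * (r * avg h (\<lambda>t. \<psi> (t, z)) r)"
  let ?c = "4 / (pi * sqrt h)"
  have im: "integrable (lborel \<Otimes>\<^sub>M lborel) (\<lambda>(r, z). ?m r z)"
    using m by (simp add: lborel_prod case_prod_beta')
  have iG: "integrable (lborel \<Otimes>\<^sub>M lborel) (\<lambda>(x, z). \<bar>abel_slice w x z\<bar>)"
    using integrable_abs[OF abel_slice_L1[OF w iw w0]] by (simp add: case_prod_beta')
  have "(\<integral>p. w p * (fst p * avg h (\<lambda>t. \<psi> (t, snd p)) (fst p)) \<partial>lborel) = (\<integral>z. \<integral>r. ?m r z \<partial>lborel \<partial>lborel)"
    unfolding lborel_pair.integral_snd[OF im] by (simp add: lborel_prod case_prod_beta')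
  also have "\<dots> \<le> (\<integral>z. ?c * (\<integral>x. \<bar>abel_slice w x z\<bar> \<partial>lborel) \<partial>lborel)"
  proof (rule integral_mono_AE)
    show "integrable lborel (\<lambda>z. \<integral>r. ?m r z \<partial>lborel)" by (rule lborel_pair.integrable_snd[OF im])
    show "integrable lborel (\<lambda>z. ?c * (\<integral>x. \<bar>abel_slice w x z\<bar> \<partial>lborel))"
      by (intro integrable_mult_right lborel_pair.integrable_snd[OF iG])
    have "integrable (lborel \<Otimes>\<^sub>M lborel) (\<lambda>(r, z). w (r, z))" using iw by (simp add: lborel_prod)
    then have "AE z in lborel. integrable lborel (\<lambda>r. w (r, z))" by (rule lborel_pair.AE_integrable_snd)
    then show "AE z in lborel. (\<integral>r. ?m r z \<partial>lborel) \<le> ?c * (\<integral>x. \<bar>abel_slice w x z\<bar> \<partial>lborel)"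
    proof eventually_elim
      case (elim z)
      obtain e where e: "0 < e" "\<And>p. \<psi> p \<noteq> 0 \<Longrightarrow> e \<le> fst p \<and> fst p \<le> 1 - e \<and> \<bar>snd p\<bar> \<le> 1 - e"
        and T: "\<psi> \<in> tensors" and \<psi>1: "\<And>p. \<bar>\<psi> p\<bar> \<le> 1"
        using \<psi> unfolding admissible_def by blast
      have "\<psi> (t, z) = 0" if "t \<le> 0" for t using e(1) e(2)[of "(t, z)"] that by (cases "\<psi> (t, z) = 0") auto
      moreover have "w (r, z) = 0" if "r \<notin> {0<..<1}" for r using that by (intro w0) (auto simp: interior_Omega)
      ultimately have "\<bar>\<integral>r. ?m r z \<partial>lborel\<bar> \<le> ?c * (\<integral>x. \<bar>\<integral>r. w (r, z) * r * abel_ker r x \<partial>lborel\<bar> \<partial>lborel)"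
        using elim by (intro averaged_pairing_bound tensors_cont_slice T \<psi>1 h)
      then show ?case unfolding abel_slice_def by linarith
    qed
  qed
  also have "\<dots> = ?c * (\<integral>p. \<bar>abel_slice w (fst p) (snd p)\<bar> \<partial>lborel)"
    using lborel_pair.integral_snd[OF iG] by (simp add: lborel_prod case_prod_beta')
  finally show ?thesis .
qed

text \<open>In particular the norm of \<open>f\<close> is finite, so that no information is lost when it is turned into a
real number.\<close>

lemma L1_norm_abel:
  assumes w [measurable]: "w \<in> borel_measurable borel" and iw: "integrable lborel w"
    and w0: "\<And>p. p \<notin> interior Omega \<Longrightarrow> w p = 0"
    and vw: "AE p in lborel. v p = w p"
    and f: "AE p in lebesgue. p \<in> {0..} \<times> UNIV \<longrightarrow> abel_transform v p = f p"
  shows "L1_norm Omega f = ennreal (\<integral>p. \<bar>abel_slice w (fst p) (snd p)\<bar> \<partial>lborel)"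
proof -
  have i: "integrable lborel (\<lambda>p. \<bar>abel_slice w (fst p) (snd p)\<bar>)"
    using integrable_abs[OF abel_slice_L1[OF w iw w0]] by (simp add: case_prod_beta lborel_prod)
  have z: "abel_slice w x z = 0" if "x \<notin> {0<..<1} \<or> z \<notin> {-1<..<1}" for x z
  proof -
    have *: "w (r, z) * r * abel_ker r x = 0" for r
      using that w0[of "(r, z)"] by (auto simp: abel_ker_def interior_Omega)
    show ?thesis unfolding abel_slice_def * by simp
  qed
  have f': "AE p in lborel. p \<in> {0..} \<times> UNIV \<longrightarrow> abel_transform v p = f p"
    using f by (rule AE_completion_iff[THEN iffD1])
  have "AE p in (lborel :: (real\<times>real) measure). fst p \<noteq> 0"
  proof -
    have "AE p in lborel \<Otimes>\<^sub>M lborel. fst (p::real\<times>real) \<noteq> 0"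
    proof (rule lborel_pair.AE_pair_measure)
      show "{p \<in> space (lborel \<Otimes>\<^sub>M lborel). fst (p::real\<times>real) \<noteq> 0} \<in> sets (lborel \<Otimes>\<^sub>M lborel)" by measurable
      show "AE x in lborel. AE y in lborel. fst (x::real, y::real) \<noteq> 0" by (rule eventually_mono[OF AE_lborel_singleton[of "0::real"]]) simp
    qed
    then show ?thesis unfolding lborel_prod .
  qed
  then have "AE p in lborel. ennreal \<bar>f p\<bar> * indicator Omega p = ennreal \<bar>abel_slice w (fst p) (snd p)\<bar>"
    using f' abel_transform_eq_slice[OF w vw]
  proof eventually_elim
    case (elim p)
    show ?case
    proof (cases "p \<in> Omega")
      case True
      then have "0 < fst p" "p \<in> {0..} \<times> UNIV" using elim(1) by (auto simp: Omega_def)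
      with elim True show ?thesis by simp
    next
      case False
      then have "fst p \<notin> {0<..<1} \<or> snd p \<notin> {-1<..<1}" by (cases p) (auto simp: Omega_def)
      then show ?thesis using False z by simp
    qed
  qed
  then have "L1_norm Omega f = (\<integral>\<^sup>+p. ennreal \<bar>abel_slice w (fst p) (snd p)\<bar> \<partial>lborel)"
    unfolding L1_norm_def nn_integral_completion by (intro nn_integral_cong_AE)
  also have "\<dots> = ennreal (\<integral>p. \<bar>abel_slice w (fst p) (snd p)\<bar> \<partial>lborel)"
    using i by (intro nn_integral_eq_integral) auto
  finally show ?thesis .
qed

section \<open>Cylindrical coordinates\<close>

text \<open>The pushforward of planar Lebesgue measure under the norm, read off from the areas of discs. The
disc of radius 2 keeps the measures finite, as the uniqueness argument requires, and contains the
unit circle in its interior.\<close>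

lemma polar_distr:
  "distr (density lborel (\<lambda>p::real\<times>real. indicator (ball 0 2) p)) borel norm =
   density lborel (\<lambda>r. ennreal (if 0 < r \<and> r < 2 then 2 * pi * r else 0))" (is "?M = ?N")
proof (rule measure_eqI_lessThan)
  have M: "emeasure ?M {x<..} = emeasure lborel (ball (0::real\<times>real) 2 \<inter> {p. x < norm p})" for x
  proof -
    have "emeasure ?M {x<..} = (\<integral>\<^sup>+p. indicator (ball (0::real\<times>real) 2) p * indicator (norm -` {x<..}) p \<partial>lborel)"
    proof -
      have "norm -` {x<..} \<in> sets (borel :: (real\<times>real) measure)" using measurable_sets[of norm borel borel "{x<..}"] by simp
      then show ?thesis by (subst emeasure_distr, simp, simp, subst emeasure_density) (auto intro!: borel_measurable_indicator)
    qed
    also have "\<dots> = (\<integral>\<^sup>+p. indicator (ball (0::real\<times>real) 2 \<inter> {p. x < norm p}) p \<partial>lborel)"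
      by (intro nn_integral_cong) (auto split: split_indicator)
    also have "\<dots> = emeasure lborel (ball (0::real\<times>real) 2 \<inter> {p. x < norm p})"
      by (rule nn_integral_indicator) simp
    finally show ?thesis .
  qed
  have vol: "emeasure lborel (cball (0::real\<times>real) r) = ennreal (pi * r\<^sup>2)" "emeasure lborel (ball (0::real\<times>real) r) = ennreal (pi * r\<^sup>2)" if "0 \<le> r" for r
    using emeasure_cball[OF that, of "0::real\<times>real"] emeasure_ball[OF that, of "0::real\<times>real"] by (simp_all add: unit_ball_vol_2 power2_eq_square)
  have N: "emeasure ?N {x<..} = ennreal (pi * 2\<^sup>2 - pi * (max 0 x)\<^sup>2)" if "x < 2" for x
  proof -
    have "emeasure ?N {x<..} = (\<integral>\<^sup>+r. ennreal (if max 0 x < r \<and> r < 2 then 2 * pi * r else 0) \<partial>lborel)"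
      by (subst emeasure_density) (auto intro!: nn_integral_cong split: split_indicator)
    also have "\<dots> = ennreal (pi * 2\<^sup>2 - pi * (max 0 x)\<^sup>2)"
      by (rule nn_integral_FTC_open) (use that in \<open>auto intro!: continuous_intros derivative_eq_intros\<close>)
    finally show ?thesis .
  qed
  show "emeasure ?M {x<..} < \<infinity>" for x
  proof -
    have "emeasure ?M {x<..} \<le> emeasure lborel (ball (0::real\<times>real) 2)"
      unfolding M by (rule emeasure_mono) auto
    also have "\<dots> < \<infinity>" by (simp add: vol)
    finally show ?thesis .
  qed
  show "emeasure ?M {x<..} = emeasure ?N {x<..}" for x
  proof -
    consider "x < 0" | "0 \<le> x" "x < 2" | "2 \<le> x" by linarith
    then show ?thesis
    proof cases
      case 1
      have "x < norm p" for p :: "real \<times> real" using 1 norm_ge_zero[of p] by linarith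
      then have "ball (0::real\<times>real) 2 \<inter> {p. x < norm p} = ball 0 2" by auto
      then show ?thesis using 1 by (simp add: M N vol del: power2_eq_square)
    next
      case 2
      have "ball (0::real\<times>real) 2 \<inter> {p. x < norm p} = ball 0 2 - cball 0 x" by auto
      then have "emeasure ?M {x<..} = emeasure lborel (ball (0::real\<times>real) 2) - emeasure lborel (cball (0::real\<times>real) x)"
        unfolding M using 2 by (simp add: vol emeasure_Diff cball_subset_ball_iff)
      also have "\<dots> = ennreal (pi * 2\<^sup>2 - pi * x\<^sup>2)"
        using 2 by (simp add: vol ennreal_minus del: ennreal_numeral)
      finally show ?thesis using 2 by (simp add: N)
    next
      case 3
      then have "ball (0::real\<times>real) 2 \<inter> {p. x < norm p} = {}" by auto
      moreover have "(\<lambda>r. ennreal (if 0 < r \<and> r < 2 then 2 * pi * r else 0) * indicator {x<..} r) = (\<lambda>r. 0)"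
        using 3 by (auto simp: fun_eq_iff split: split_indicator)
      then have "emeasure ?N {x<..} = 0" by (subst emeasure_density) simp_all
      ultimately show ?thesis by (simp only: M emeasure_empty)
    qed
  qed
qed simp_all

lemma nn_integral_radial:
  fixes a :: "real \<Rightarrow> ennreal"
  assumes [measurable]: "a \<in> borel_measurable borel" and a0: "\<And>r. 2 \<le> r \<Longrightarrow> a r = 0"
  shows "(\<integral>\<^sup>+p. a (norm p) \<partial>(lborel :: (real\<times>real) measure)) = (\<integral>\<^sup>+r. ennreal (if 0 < r then 2 * pi * r else 0) * a r \<partial>lborel)"
proof -
  have "(\<integral>\<^sup>+p. a (norm p) \<partial>(lborel :: (real\<times>real) measure)) 
      = (\<integral>\<^sup>+p. indicator (ball 0 2) p * a (norm p) \<partial>(lborel :: (real\<times>real) measure))"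
    by (intro nn_integral_cong) (auto simp: a0 split: split_indicator)
  also have "\<dots> = (\<integral>\<^sup>+r. a r \<partial>distr (density lborel (\<lambda>p::real\<times>real. indicator (ball 0 2) p)) borel norm)"
    by (subst nn_integral_distr, simp, simp, subst nn_integral_density) (auto intro!: borel_measurable_indicator)
  also have "\<dots> = (\<integral>\<^sup>+r. ennreal (if 0 < r \<and> r < 2 then 2 * pi * r else 0) * a r \<partial>lborel)"
    unfolding polar_distr by (rule nn_integral_density) measurable
  also have "\<dots> = (\<integral>\<^sup>+r. ennreal (if 0 < r then 2 * pi * r else 0) * a r \<partial>lborel)"
    by (intro nn_integral_cong) (auto simp: a0 not_less)
  finally show ?thesis .
qed

lemma nn_integral_cylindrical:
  fixes A :: "real \<times> real \<Rightarrow> ennreal"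
  assumes A [measurable]: "A \<in> borel_measurable borel" and A0: "\<And>r z. 2 \<le> r \<Longrightarrow> A (r, z) = 0"
  shows "(\<integral>\<^sup>+q. A (sqrt ((fst q)\<^sup>2 + (fst (snd q))\<^sup>2), snd (snd q)) \<partial>(lborel :: (real\<times>real\<times>real) measure))
       = (\<integral>\<^sup>+p. ennreal (if 0 < fst p then 2 * pi * fst p else 0) * A p \<partial>lborel)"
proof -
  define H where "H x y z = A (sqrt (x\<^sup>2 + y\<^sup>2), z)" for x y z
  have [measurable]: "(\<lambda>x. A (f x, g x)) \<in> borel_measurable M" if [measurable]: "f \<in> borel_measurable M" "g \<in> borel_measurable M" for f g M
    using measurable_compose[OF borel_measurable_Pair[OF that] A] .
  have [measurable]: "fst \<in> borel_measurable borel" "snd \<in> borel_measurable borel" by (auto intro!: borel_measurable_continuous_onI continuous_intros)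
  have "(\<integral>\<^sup>+q. H (fst q) (fst (snd q)) (snd (snd q)) \<partial>(lborel :: (real\<times>real\<times>real) measure))
      = (\<integral>\<^sup>+x. \<integral>\<^sup>+s. H x (fst s) (snd s) \<partial>lborel \<partial>lborel)"
    unfolding H_def by (subst nn_integral_lborel_pair(1)) simp_all
  also have "\<dots> = (\<integral>\<^sup>+x. \<integral>\<^sup>+z. \<integral>\<^sup>+y. H x y z \<partial>lborel \<partial>lborel \<partial>lborel)"
    unfolding H_def by (subst nn_integral_lborel_pair(2)) simp_all
  also have "\<dots> = (\<integral>\<^sup>+z. \<integral>\<^sup>+x. \<integral>\<^sup>+y. H x y z \<partial>lborel \<partial>lborel \<partial>lborel)"
    unfolding H_def by (rule lborel_pair.Fubini'[symmetric]) measurable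
  also have "\<dots> = (\<integral>\<^sup>+z. \<integral>\<^sup>+p. A (norm p, z) \<partial>(lborel::(real\<times>real) measure) \<partial>lborel)"
    unfolding H_def by (subst nn_integral_lborel_pair(1)) (simp_all add: norm_Pair)
  also have "\<dots> = (\<integral>\<^sup>+z. \<integral>\<^sup>+r. ennreal (if 0 < r then 2 * pi * r else 0) * A (r, z) \<partial>lborel \<partial>lborel)"
    by (subst nn_integral_radial) (simp_all add: A0)
  also have "\<dots> = (\<integral>\<^sup>+p. ennreal (if 0 < fst p then 2 * pi * fst p else 0) * A p \<partial>lborel)"
    by (subst nn_integral_lborel_pair(2)) (simp_all cong: if_cong)
  finally show ?thesis by (simp add: H_def)
qed

text \<open>The set where the profile differs from its Borel representative is null in the \<open>(r,z)\<close> half-plane;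
cylindrical coordinates show that the set of points of space above it is null as well. The lateral
boundary \<open>r = 1\<close>, where the profile is zero whatever \<open>u\<close> is, is discarded in the same way.\<close>

lemma cylinder_L1_norm:
  assumes "axisymmetric u" and w [measurable]: "w \<in> borel_measurable borel"
    and ae: "AE p in lborel. profile u p = w p" and w0: "\<And>p. p \<notin> interior Omega \<Longrightarrow> w p = 0"
  shows "L1_norm cylinder u = (\<integral>\<^sup>+p. ennreal (2 * pi * (\<bar>w p\<bar> * fst p)) \<partial>lborel)"
proof -
  define \<rho> :: "real \<times> real \<times> real \<Rightarrow> real \<times> real"
    where "\<rho> q = (sqrt ((fst q)\<^sup>2 + (fst (snd q))\<^sup>2), snd (snd q))" for q
  have [measurable]: "\<rho> \<in> borel_measurable borel"
    unfolding \<rho>_def[abs_def] by (auto intro!: borel_measurable_continuous_onI continuous_intros)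
  obtain N where N: "N \<in> null_sets lborel" and [measurable]: "N \<in> sets borel"
    and N_eq: "\<And>p. p \<notin> N \<Longrightarrow> profile u p = w p"
    by (rule lborel_null_cover[OF ae]) blast
  \<comment> \<open>The cut at \<open>r = 2\<close> is what \<open>nn_integral_cylindrical\<close> asks for; the cylinder lies below it.\<close>
  define B where "B = (N \<union> {1} \<times> UNIV) \<inter> {..<2} \<times> UNIV"
  have [measurable]: "{1::real} \<times> (UNIV::real set) \<in> sets borel" "{..<2::real} \<times> (UNIV::real set) \<in> sets borel"
    by (rule borel_closed borel_open, simp add: closed_Times open_Times)+
  have one: "{1::real} \<times> (UNIV::real set) \<in> null_sets lborel"
  proof -
    have "emeasure (lborel \<Otimes>\<^sub>M lborel) ({1::real} \<times> (UNIV::real set)) = emeasure lborel {1::real} * emeasure lborel (UNIV::real set)"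
      by (rule lborel.emeasure_pair_measure_Times) simp_all
    then show ?thesis by (simp add: null_sets_def lborel_prod)
  qed
  have B: "AE p in lborel. p \<notin> B" 
    using AE_not_in[OF N] AE_not_in[OF one] by eventually_elim (simp add: B_def)
  have [measurable]: "B \<in> sets borel" unfolding B_def by measurable
  have "(\<integral>\<^sup>+q. indicator B (\<rho> q) \<partial>lborel) = (\<integral>\<^sup>+p. ennreal (if 0 < fst p then 2 * pi * fst p else 0) * indicator B p \<partial>lborel)"
    unfolding \<rho>_def by (rule nn_integral_cylindrical) (auto simp: B_def)
  also have "\<dots> = (\<integral>\<^sup>+p. 0 \<partial>(lborel :: (real\<times>real) measure))"
    using B by (intro nn_integral_cong_AE, eventually_elim) simp
  finally have "(\<integral>\<^sup>+q. indicator B (\<rho> q) \<partial>lborel) = 0" by simp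
  then have "AE q in lborel. indicator B (\<rho> q) = (0::ennreal)"
    by (subst (asm) nn_integral_0_iff_AE) auto
  then have "AE q in lborel. \<rho> q \<notin> B"
    by eventually_elim (simp add: indicator_def split: if_splits)
  then have aeq: "AE q in lebesgue. \<rho> q \<notin> B" by (rule AE_completion)
  obtain V where V: "\<And>x y z. (x, y, z) \<in> cylinder \<Longrightarrow> u (x, y, z) = V (sqrt (x\<^sup>2 + y\<^sup>2)) z"
    using assms(1) unfolding axisymmetric_def by blast
  have eq: "ennreal \<bar>u q\<bar> * indicator cylinder q = ennreal \<bar>w (\<rho> q)\<bar>" if q: "\<rho> q \<notin> B" for q
  proof -
    obtain x y z where [simp]: "q = (x, y, z)" by (cases q)
    define r where "r = sqrt (x\<^sup>2 + y\<^sup>2)"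
    have \<rho>: "\<rho> q = (r, z)" and [simp]: "\<rho> (x, y, z) = (r, z)" by (simp_all add: \<rho>_def r_def)
    have r0: "0 \<le> r" "r\<^sup>2 = x\<^sup>2 + y\<^sup>2" by (simp_all add: r_def)
    show ?thesis
    proof (cases "q \<in> cylinder")
      case True
      then have c: "r \<le> 1" "-1 \<le> z" "z \<le> 1" by (auto simp: cylinder_def r_def)
      then have r1: "r < 1" "(r, z) \<notin> N" using q unfolding \<rho> B_def by (cases "r = 1"; auto)+
      have "(r, 0, z) \<in> cylinder" using True r0 by (simp add: cylinder_def)
      then have "u (r, 0, z) = V r z" using V[of r 0 z] r0(1) by simp
      also have "\<dots> = u q" using V[of x y z] True by (simp add: r_def)
      finally have "profile u (r, z) = u q" using r0 r1 c by (simp add: profile_def)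
      moreover have "profile u (r, z) = w (r, z)" using r1(2) by (rule N_eq)
      ultimately show ?thesis using True by simp
    next
      case False
      then have "(r, z) \<notin> interior Omega"
        using r0 by (auto simp: cylinder_def interior_Omega r_def)
      then show ?thesis using False by (simp add: w0)
    qed
  qed
  have "L1_norm cylinder u = (\<integral>\<^sup>+q. ennreal \<bar>w (\<rho> q)\<bar> \<partial>lebesgue)"
    unfolding L1_norm_def using aeq by (intro nn_integral_cong_AE, eventually_elim) (rule eq)
  also have "\<dots> = (\<integral>\<^sup>+q. ennreal \<bar>w (\<rho> q)\<bar> \<partial>lborel)" by (rule nn_integral_completion)
  also have "\<dots> = (\<integral>\<^sup>+p. ennreal (if 0 < fst p then 2 * pi * fst p else 0) * ennreal \<bar>w p\<bar> \<partial>lborel)"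
    unfolding \<rho>_def by (rule nn_integral_cylindrical) (auto simp: w0 interior_Omega)
  also have "\<dots> = (\<integral>\<^sup>+p. ennreal (2 * pi * (\<bar>w p\<bar> * fst p)) \<partial>lborel)"
  proof (intro nn_integral_cong)
    fix p
    show "ennreal (if 0 < fst p then 2 * pi * fst p else 0) * ennreal \<bar>w p\<bar> = ennreal (2 * pi * (\<bar>w p\<bar> * fst p))"
    proof (cases "0 < fst p")
      case False
      then have "w p = 0" by (intro w0) (auto simp: interior_Omega)
      then show ?thesis by simp
    qed (simp add: ennreal_mult[symmetric] mult_ac)
  qed
  finally show ?thesis .
qed

section \<open>The interpolation inequality\<close>

text \<open>The essential support avoids the compact segment \<open>r = 1\<close>. Finitely many open sets on which \<open>v\<close>
vanishes almost everywhere cover the segment, hence also a strip along it.\<close>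

lemma vanishes_near_lateral_boundary:
  assumes ess: "ess_support v \<subseteq> {0..<1} \<times> {-1..1}" and ae: "AE p in lborel. v p = w p"
    and w0: "\<And>p. p \<notin> interior Omega \<Longrightarrow> w p = 0"
  obtains \<delta> where "0 < \<delta>" "AE p in lborel. 1 - \<delta> \<le> fst p \<longrightarrow> w p = 0"
proof -
  let ?K = "{1::real} \<times> {-1..1::real}"
  let ?F = "{W. open W \<and> (AE q in lebesgue. q \<in> W \<longrightarrow> v q = 0)}"
  have "p \<in> \<Union>?F" if "p \<in> ?K" for p
  proof -
    have "p \<notin> ess_support v" using ess that by auto
    then show ?thesis unfolding ess_support_def by blast
  qed
  then have sub: "?K \<subseteq> \<Union>?F" by blast
  have K: "compact ?K" by (intro compact_Times) auto
  obtain \<W> where W: "\<W> \<subseteq> ?F" "finite \<W>" "?K \<subseteq> \<Union>\<W>"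
    by (rule compactE[OF K sub]) simp_all
  have W_open: "open W" and W_ae: "AE q in lebesgue. q \<in> W \<longrightarrow> v q = 0" if "W \<in> \<W>" for W
    using W(1) that by (simp_all add: subset_iff)
  have vW: "AE q in lborel. q \<in> \<Union>\<W> \<longrightarrow> v q = 0"
  proof -
    have "AE q in lebesgue. \<forall>W\<in>\<W>. q \<in> W \<longrightarrow> v q = 0" using W(2) W_ae by (rule AE_finite_allI)
    then have "AE q in lborel. \<forall>W\<in>\<W>. q \<in> W \<longrightarrow> v q = 0" by (rule AE_completion_iff[THEN iffD1])
    then show ?thesis by eventually_elim simp
  qed
  obtain e where e: "0 < e" "(\<Union>x\<in>?K. ball x e) \<subseteq> \<Union>\<W>"
    by (rule compact_subset_open_imp_ball_epsilon_subset[OF K _ W(3)]) (auto intro: W_open)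
  have "p \<in> \<Union>\<W>" if "1 - e / 2 \<le> fst p" "p \<in> interior Omega" for p
  proof -
    have "p \<in> ball (1, snd p) e" using that e(1) by (cases p) (auto simp: interior_Omega dist_Pair_Pair dist_real_def)
    moreover have "(1, snd p) \<in> ?K" using that(2) by (auto simp: interior_Omega)
    ultimately show ?thesis using e(2) by blast
  qed
  note near = this
  have "AE p in lborel. 1 - e / 2 \<le> fst p \<longrightarrow> w p = 0"
    using vW ae
  proof eventually_elim
    case (elim p)
    then show ?case using near[of p] w0[of p] by (cases "p \<in> interior Omega") auto
  qed
  then show thesis using e(1) by (intro that[of "e / 2"]) auto
qed

text \<open>The boundary of the rectangle is a null set, so the representative may be taken to vanish on it.\<close>

lemma borel_representative:
  assumes "set_integrable lebesgue (interior Omega) v" and v0: "\<And>p. p \<notin> Omega \<Longrightarrow> v p = 0"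
  obtains w :: "real \<times> real \<Rightarrow> real" where "w \<in> borel_measurable borel" "integrable lborel w"
    "AE p in lborel. v p = w p" "\<And>p. p \<notin> interior Omega \<Longrightarrow> w p = 0"
proof -
  have i: "integrable lebesgue (\<lambda>p. indicator (interior Omega) p * v p)"
    using assms(1) by (simp add: set_integrable_def)
  then obtain g where g [measurable]: "g \<in> borel_measurable borel" and 
    ae: "AE p in lborel. indicator (interior Omega) p * v p = g p"
    using completion_ex_borel_measurable_real[of "\<lambda>p. indicator (interior Omega) p * v p" lborel] by auto
  define w where "w p = indicator (interior Omega) p * g p" for p
  have wm [measurable]: "w \<in> borel_measurable borel" unfolding w_def[abs_def] by measurable
  have ae2: "AE p in lborel. indicator (interior Omega) p * v p = w p"
    using ae by eventually_elim (auto simp: w_def split: split_indicator)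
  have "integrable lebesgue w"
    by (rule integrable_cong_AE_imp[OF i]) (use ae2 in \<open>auto intro!: AE_completion measurable_completion elim!: eventually_mono\<close>)
  then have iw: "integrable lborel w" by (subst (asm) integrable_completion) auto
  have "convex Omega" "closed Omega" by (auto simp: Omega_def intro!: convex_Times closed_Times)
  then have "Omega - interior Omega \<in> null_sets lebesgue"
    using negligible_convex_frontier[of Omega] by (simp add: frontier_def negligible_iff_null_sets)
  then have "AE p in lborel. p \<notin> Omega - interior Omega"
    by (intro AE_completion_iff[THEN iffD1, OF AE_not_in])
  then have ae3: "AE p in lborel. v p = w p"
    using ae2 by eventually_elim (use v0 in \<open>auto simp: w_def split: split_indicator_asm\<close>)
  show thesis by (rule that[OF wm iw ae3]) (simp add: w_def)
qed

lemma weighted_L1_bound: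
  assumes w [measurable]: "w \<in> borel_measurable borel" and iw: "integrable lborel w"
    and w0: "\<And>p. p \<notin> interior Omega \<Longrightarrow> w p = 0"
    and vw: "AE p in lborel. v p = w p"
    and \<delta>: "0 < \<delta>" "AE p in lborel. 1 - \<delta> \<le> fst p \<longrightarrow> w p = 0"
    and TV: "TV v < \<infinity>" and h: "0 < h"
  shows "(\<integral>p. \<bar>w p\<bar> * fst p \<partial>lborel)
     \<le> 2 * h * enn2real (TV v) + 4 / (pi * sqrt h) * (\<integral>p. \<bar>abel_slice w (fst p) (snd p)\<bar> \<partial>lborel)"
    (is "_ \<le> ?K")
proof -
  define g where "g p = w p * fst p" for p
  have bnd: "integrable lborel (\<lambda>p. w p * k p)" if [measurable]: "k \<in> borel_measurable borel" 
    and k: "\<And>p. p \<in> interior Omega \<Longrightarrow> \<bar>k p\<bar> \<le> 1" for k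
  proof (rule Bochner_Integration.integrable_bound[OF iw])
    show "AE p in lborel. norm (w p * k p) \<le> norm (w p)"
    proof (intro always_eventually allI)
      fix p show "norm (w p * k p) \<le> norm (w p)"
        using k[of p] w0[of p] by (cases "p \<in> interior Omega") (auto simp: abs_mult intro!: mult_left_le)
    qed
  qed measurable
  have [measurable]: "(fst :: real\<times>real \<Rightarrow> real) \<in> borel_measurable borel" by (auto intro!: borel_measurable_continuous_onI continuous_intros)
  have "integrable lborel g" unfolding g_def[abs_def] by (rule bnd) (auto simp: interior_Omega)
  then have "(\<integral>p. \<bar>g p\<bar> \<partial>lborel) \<le> ?K"
  proof (rule L1_bound_by_duality)
    show "g p = 0" if "p \<notin> interior Omega" for p using w0[OF that] by (simp add: g_def)
    fix \<psi> assume \<psi>: "admissible \<psi>"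
    then have T: "\<psi> \<in> tensors" and \<psi>1: "\<And>p. \<bar>\<psi> p\<bar> \<le> 1" unfolding admissible_def by auto
    note [measurable] = admissible_measurable[OF \<psi>]
    define a where "a p = avg h (\<lambda>t. \<psi> (t, snd p)) (fst p)" for p
    have a1: "\<bar>a p\<bar> \<le> 1" for p unfolding a_def by (intro abs_avg_le_1 tensors_cont_slice T \<psi>1 h)
    have "continuous_on UNIV (\<lambda>p. fst p * (\<psi> p - a p))"
      using tensors_osc_C1[OF T h, of "\<lambda>_. 0" "\<lambda>_. 1"] unfolding C1_on_plane_def a_def by simp
    then have D [measurable]: "(\<lambda>p. fst p * (\<psi> p - a p)) \<in> borel_measurable borel" by (rule borel_measurable_continuous_onI)
    have "(\<lambda>p. fst p * \<psi> p - fst p * (\<psi> p - a p)) \<in> borel_measurable borel" by measurable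
    then have A: "(\<lambda>p. fst p * a p) \<in> borel_measurable borel" by (simp add: algebra_simps)
    have ia: "integrable lborel (\<lambda>p. w p * (fst p * a p))"
    proof (rule bnd[OF A])
      fix p assume "p \<in> interior Omega"
      then show "\<bar>fst p * a p\<bar> \<le> 1" using a1[of p] by (auto simp: interior_Omega abs_mult intro!: mult_le_one)
    qed
    have i\<psi>: "integrable lborel (\<lambda>p. w p * (fst p * \<psi> p))"
    proof (rule bnd)
      fix p assume "p \<in> interior Omega"
      then show "\<bar>fst p * \<psi> p\<bar> \<le> 1" using \<psi>1[of p] by (auto simp: interior_Omega abs_mult intro!: mult_le_one)
    qed measurable
    have "(\<integral>p. g p * \<psi> p \<partial>lborel) = (\<integral>p. w p * (fst p * \<psi> p) - w p * (fst p * a p) \<partial>lborel) + (\<integral>p. w p * (fst p * a p) \<partial>lborel)"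
      using ia i\<psi> by (simp add: g_def mult.assoc)
    also have "(\<integral>p. w p * (fst p * \<psi> p) - w p * (fst p * a p) \<partial>lborel) = (\<integral>p. w p * (fst p * (\<psi> p - a p)) \<partial>lborel)"
      by (simp only: right_diff_distrib)
    also have "\<dots> \<le> 2 * h * enn2real (TV v)"
      unfolding a_def
    proof (rule TV_controls_oscillation[OF w _ _ \<delta> TV \<psi> h])
      show "AE p in lborel. p \<in> Omega \<longrightarrow> v p = w p" using vw by eventually_elim simp
      show "w p = 0" if "p \<notin> Omega" for p using that interior_subset by (intro w0) blast
    qed
    also have "(\<integral>p. w p * (fst p * a p) \<partial>lborel) \<le> 4 / (pi * sqrt h) * (\<integral>p. \<bar>abel_slice w (fst p) (snd p)\<bar> \<partial>lborel)"
      unfolding a_def by (rule averaged_pairing_bound_plane[OF w iw _ \<psi> h ia[unfolded a_def], OF w0])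
    finally show "(\<integral>p. g p * \<psi> p \<partial>lborel) \<le> ?K" by simp
  qed
  moreover have "\<bar>g p\<bar> = \<bar>w p\<bar> * fst p" for p
    using w0[of p] by (cases "p \<in> interior Omega") (auto simp: g_def abs_mult interior_Omega)
  ultimately show ?thesis by simp
qed

text \<open>The degenerate cases \<open>N = 0\<close> and \<open>T = 0\<close>, where the balancing \<open>h\<close> is not available, follow from
\<open>h \<rightarrow> 0\<close> and \<open>h \<rightarrow> \<infinity>\<close>: a positive \<open>I\<close> is refuted by a suitable finite \<open>h\<close>.\<close>

lemma interpolate_minimum:
  fixes I T N c :: real
  assumes "0 \<le> T" "0 \<le> N" "0 \<le> c" and I: "\<And>h. 0 < h \<Longrightarrow> I \<le> 2 * h * T + c / sqrt h * N"
  shows "I \<le> (2 + c) * T powr (1/3) * N powr (2/3)"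
proof (cases "I \<le> 0")
  case True
  have "0 \<le> (2 + c) * T powr (1/3) * N powr (2/3)" using assms by simp
  with True show ?thesis by linarith
next
  case False
  then have I0: "0 < I" by simp
  have N0: "0 < N"
  proof (rule ccontr)
    assume "\<not> 0 < N"
    then have "I \<le> 2 * (I / (4 * (T + 1))) * T" using I[of "I / (4 * (T + 1))"] I0 assms by simp
    also have "\<dots> = I * (T / (2 * (T + 1)))" using assms by (simp add: field_simps)
    also have "\<dots> < I * 1" using I0 assms by (intro mult_strict_left_mono) (auto simp: field_simps)
    finally show False by simp
  qed
  have T0: "0 < T"
  proof (rule ccontr)
    assume "\<not> 0 < T"
    \<comment> \<open>With \<open>h = s\<^sup>2\<close> the assumption reads \<open>I s \<le> c N\<close>, which this \<open>s\<close> violates.\<close>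
    define s where "s = 2 * c * N / I + 1"
    have s: "0 < s" using I0 assms by (auto simp: s_def intro!: add_nonneg_pos)
    have "I \<le> c / s * N" using I[of "s\<^sup>2"] s \<open>\<not> 0 < T\<close> assms by simp
    then have "I * s \<le> c * N" using s by (simp add: field_simps)
    moreover have "I * s = 2 * (c * N) + I" using I0 by (simp add: s_def field_simps)
    moreover have "0 \<le> c * N" using assms by simp
    ultimately show False using I0 by linarith
  qed
  define h where "h = (N / T) powr (2/3)"
  have h: "0 < h" using N0 T0 by (simp add: h_def)
  have "sqrt h = (N / T) powr (1/3)"
    unfolding h_def using N0 T0 by (simp add: powr_half_sqrt[symmetric] powr_powr)
  then have sh: "sqrt h = N powr (1/3) / T powr (1/3)" using N0 T0 by (simp add: powr_divide)
  have N1: "N = N powr (1/3) * N powr (2/3)" and T1: "T = T powr (2/3) * T powr (1/3)"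
    using N0 T0 by (simp_all add: powr_add[symmetric])
  have "h * T = T powr (1/3) * N powr (2/3)"
  proof -
    have "h * T = N powr (2/3) / T powr (2/3) * (T powr (2/3) * T powr (1/3))"
      unfolding h_def T1[symmetric] using N0 T0 by (simp add: powr_divide)
    then show ?thesis using T0 by simp
  qed
  moreover have "c / sqrt h * N = c * (T powr (1/3) * N powr (2/3))"
  proof -
    have "c / sqrt h * N = c / (N powr (1/3) / T powr (1/3)) * (N powr (1/3) * N powr (2/3))"
      unfolding sh N1[symmetric] ..
    then show ?thesis using N0 T0 by simp
  qed
  ultimately show ?thesis using I[OF h] by (simp add: algebra_simps)
qed

text \<open>The constant is \<open>2 \<pi> (2 + 4 / \<pi>)\<close>, with \<open>2 \<pi>\<close> from cylindrical coordinates and \<open>2 + 4 / \<pi>\<close> from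
balancing the two error terms.\<close>

lemma abel_stability:
  assumes u: "axisymmetric u" and BV: "profile u \<in> BV"
    and supp: "ess_support (profile u) \<subseteq> {0..<1} \<times> {-1..1}"
    and f: "AE p in lebesgue. p \<in> {0..} \<times> UNIV \<longrightarrow> abel_transform (profile u) p = f p"
  shows "L1_norm cylinder u \<le>
     ennreal ((4 * pi + 8) * enn2real (TV (profile u)) powr (1/3) * enn2real (L1_norm Omega f) powr (2/3))"
proof -
  have TV: "TV (profile u) < \<infinity>" and si: "set_integrable lebesgue (interior Omega) (profile u)"
    using BV by (auto simp: BV_def)
  have "profile u p = 0" if "p \<notin> Omega" for p
    using that by (cases p) (auto simp: profile_def Omega_def)
  then obtain w where w: "w \<in> borel_measurable borel" "integrable lborel w"
    "AE p in lborel. profile u p = w p" "\<And>p. p \<notin> interior Omega \<Longrightarrow> w p = 0"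
    using borel_representative[OF si] by blast
  obtain \<delta> where \<delta>: "0 < \<delta>" "AE p in lborel. 1 - \<delta> \<le> fst p \<longrightarrow> w p = 0"
    using vanishes_near_lateral_boundary[OF supp w(3,4)] by blast
  define I where "I = (\<integral>p. \<bar>w p\<bar> * fst p \<partial>lborel)"
  define T where "T = enn2real (TV (profile u))"
  define N where "N = (\<integral>p. \<bar>abel_slice w (fst p) (snd p)\<bar> \<partial>lborel)"
  have fN: "enn2real (L1_norm Omega f) = N"
    using L1_norm_abel[OF w(1,2) _ w(3) f] w(4) by (simp add: N_def)
  have "I \<le> 2 * h * T + (4 / pi) / sqrt h * N" if "0 < h" for h
    using weighted_L1_bound[OF w(1,2,4,3) \<delta> TV that] by (simp add: I_def T_def N_def)
  then have I: "I \<le> (2 + 4 / pi) * T powr (1/3) * N powr (2/3)"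
    by (intro interpolate_minimum) (auto simp: T_def N_def)
  have wf: "0 \<le> \<bar>w p\<bar> * fst p" "norm (\<bar>w p\<bar> * fst p) \<le> norm (w p)" for p
    using w(4)[of p] by (cases "p \<in> interior Omega"; auto simp: interior_Omega abs_mult intro!: mult_left_le)+
  have "(fst :: real\<times>real \<Rightarrow> real) \<in> borel_measurable borel" by (auto intro!: borel_measurable_continuous_onI continuous_intros)
  then have "integrable lborel (\<lambda>p. \<bar>w p\<bar> * fst p)"
    using w(1) wf by (intro Bochner_Integration.integrable_bound[OF w(2)]) auto
  then have "integrable lborel (\<lambda>p. 2 * pi * (\<bar>w p\<bar> * fst p))" by (rule integrable_mult_right)
  then have "(\<integral>\<^sup>+p. ennreal (2 * pi * (\<bar>w p\<bar> * fst p)) \<partial>lborel) = ennreal (\<integral>p. 2 * pi * (\<bar>w p\<bar> * fst p) \<partial>lborel)"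
    using wf by (intro nn_integral_eq_integral) auto
  then have "L1_norm cylinder u = ennreal (2 * pi * I)"
    using cylinder_L1_norm[OF u w(1,3)] w(4) by (simp add: I_def)
  also have "2 * pi * I \<le> 2 * pi * ((2 + 4 / pi) * T powr (1/3) * N powr (2/3))"
    using I by (intro mult_left_mono) auto
  also have "\<dots> = (4 * pi + 8) * T powr (1/3) * N powr (2/3)" by (simp add: field_simps)
  finally show ?thesis unfolding fN T_def by (simp add: ennreal_leI)
qed

theorem theoremA8:
  "\<exists>C::real. \<forall>(u :: real \<times> real \<times> real \<Rightarrow> real) (f :: real \<times> real \<Rightarrow> real).
     axisymmetric u \<longrightarrow>
     profile u \<in> BV \<longrightarrow>
     ess_support (profile u) \<subseteq> {0..<1} \<times> {-1..1} \<longrightarrow>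
     (AE p in lebesgue. p \<in> {0..} \<times> UNIV \<longrightarrow> abel_transform (profile u) p = f p) \<longrightarrow>
     L1_norm cylinder u \<le>
       ennreal (C * enn2real (TV (profile u)) powr (1/3) * enn2real (L1_norm Omega f) powr (2/3))"
  using abel_stability by (intro exI[of _ "4 * pi + 8"] allI impI)

end
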